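(* Let $\mathscr{M}$ be the Mumford operator $$\mathscr{M}u:=\partial_tu-\cos(x)\,\partial_yu-\sin(x)\,\partial_wu-\partial_x^2u,\qquad(x,y,w,t)\in\mathbb{R}^4,$$ let $0<T\le+\infty$, $S_T:=\mathbb{R}^3\times\,]0,T[$, and let $u_0\ge0$ be a continuous function in $\mathbb{R}^3$. Then the positive Cauchy problem $$\begin{cases} \mathscr{M}u(x,y,w,t)=0, & (x,y,w,t)\in S_T, \\ {} u(x,y,w,0)=u_0(x,y,w), & (x,y,w)\in\mathbb{R}^3, \\ {} u(x,y,w,t)\ge0, & (x,y,w,t)\in S_T, \end{cases}$$ admits at most one solution.
   Context: A solution of the positive Cauchy problem is a function $u$ that is $C^\infty$ in $S_T$, continuous up to $t=0$ (i.e. on $\mathbb{R}^3\times[0,T[$), and satisfies the three conditions. *)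

theory Defs
  imports "HOL-Analysis.Analysis"
begin

text \<open>Meant for open \<open>S\<close>: the derivatives are full Frechet derivatives at the points of \<open>S\<close>.
  On an open subset of a Euclidean space this is the usual class of functions all of whose
  partial derivatives up to order \<open>k\<close> exist and are continuous.\<close>
primrec Ck_on ::
  "nat \<Rightarrow> ('a::real_normed_vector \<Rightarrow> 'b::real_normed_vector) \<Rightarrow> 'a set \<Rightarrow> bool" where
  "Ck_on 0 f S \<longleftrightarrow> continuous_on S f"
| "Ck_on (Suc k) f S \<longleftrightarrow>
     (\<forall>p\<in>S. f differentiable (at p)) \<and>
     (\<forall>v. Ck_on k (\<lambda>p. frechet_derivative f (at p) v) S)"

definition Cinf_on ::
  "('a::real_normed_vector \<Rightarrow> 'b::real_normed_vector) \<Rightarrow> 'a set \<Rightarrow> bool" where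
  "Cinf_on f S \<longleftrightarrow> (\<forall>k. Ck_on k f S)"

text \<open>Points of four-dimensional space are written \<open>(x, y, w, t)\<close>.\<close>
definition mumford ::
  "(real \<times> real \<times> real \<times> real \<Rightarrow> real) \<Rightarrow> real \<times> real \<times> real \<times> real \<Rightarrow> real" where
  "mumford u = (\<lambda>(x, y, w, t).
     deriv (\<lambda>s. u (x, y, w, s)) t
     - cos x * deriv (\<lambda>s. u (x, s, w, t)) y
     - sin x * deriv (\<lambda>s. u (x, y, s, t)) w
     - (deriv ^^ 2) (\<lambda>s. u (s, y, w, t)) x)"

text \<open>The bound \<open>T\<close> is an extended real, so that \<open>T = \<infinity>\<close> is allowed.\<close>
definition open_strip :: "ereal \<Rightarrow> (real \<times> real \<times> real \<times> real) set" where
  "open_strip T = {(x, y, w, t). 0 < t \<and> ereal t < T}"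

definition half_open_strip :: "ereal \<Rightarrow> (real \<times> real \<times> real \<times> real) set" where
  "half_open_strip T = {(x, y, w, t). 0 \<le> t \<and> ereal t < T}"

text \<open>Solutions live on \<open>half_open_strip T\<close>; the values of the total function \<open>u\<close> outside this
  set are irrelevant.\<close>
definition positive_cauchy_solution ::
  "ereal \<Rightarrow> (real \<times> real \<times> real \<Rightarrow> real) \<Rightarrow> (real \<times> real \<times> real \<times> real \<Rightarrow> real) \<Rightarrow> bool" where
  "positive_cauchy_solution T u0 u \<longleftrightarrow>
     Cinf_on u (open_strip T) \<and>
     continuous_on (half_open_strip T) u \<and>
     (\<forall>p\<in>open_strip T. mumford u p = 0) \<and>
     (\<forall>x y w. u (x, y, w, 0) = u0 (x, y, w)) \<and>
     (\<forall>p\<in>open_strip T. 0 \<le> u p)"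

end

theory Submission
  imports Defs
begin

text \<open>
No Harnack inequality is needed, because the drift \<open>(cos x, sin x)\<close> has length one: perturbations
travel at speed at most one in \<open>(y, w)\<close> (with \<open>z\<close> for \<open>w\<close> in the lemmas) and diffuse only in \<open>x\<close>. Hence a power of
\<open>(a \<plusminus> t)\<^sup>2 - y\<^sup>2 - z\<^sup>2\<close>, cut off at \<open>0\<close>, is a sub- (\<open>+\<close>) or supersolution (\<open>-\<close>) of the
adjoint transport equation. In \<open>x\<close> we use \<open>h = (max 0 (g - \<epsilon>))\<^sup>3\<close>, where \<open>g\<^sup>3\<close> is the backward heat
kernel \<open>exp (- x\<^sup>2 / (4 s)) / sqrt s\<close> with \<open>s = S - t\<close>; it has compact support, is \<open>C\<^sup>2\<close> and satisfies
\<open>h\<^sub>t + h\<^sub>x\<^sub>x = \<epsilon> x\<^sup>2 / (6 s\<^sup>2) * max 0 (g - \<epsilon>) * g\<close>, which is nonnegative and of order \<open>\<epsilon>\<close>.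

With the sign \<open>+\<close>, testing a nonnegative solution gives a Gaussian weighted \<open>L\<^sup>1\<close> bound that is uniform
in \<open>\<epsilon>\<close> and \<open>t\<close>. With the sign \<open>-\<close> and a faster decaying kernel, testing the subsolution
\<open>sqrt (1 + (u - v)\<^sup>2) - 1 \<le> u + v\<close> gives an integral that vanishes at the initial time and grows at
most at rate \<open>O(\<epsilon>)\<close>, by the first bound. Letting \<open>\<epsilon>\<close> tend to \<open>0\<close> yields \<open>u = v\<close> on a short time
interval whose length does not depend on the starting time.
\<close>

subsection \<open>Green's identity\<close>

text \<open>Fubini moves the integration in the differentiated variable innermost. There the
  fundamental theorem of calculus leaves only the values of \<open>F\<close> on two opposite faces,
  which vanish. The versions for \<open>y\<close> and \<open>z\<close> follow the same
  scheme.\<close>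

lemma integral_partial_x_zero:
  fixes F F' :: "real \<times> real \<times> real \<Rightarrow> real"
  assumes XY: "0 \<le> X" and c: "continuous_on (cbox (-X,-Y,-Z) (X,Y,Z)) F'"
    and d: "\<And>x y z. ((\<lambda>x. F (x,y,z)) has_real_derivative F' (x,y,z)) (at x)"
    and b: "\<And>y z. \<bar>y\<bar> \<le> Y \<Longrightarrow> \<bar>z\<bar> \<le> Z \<Longrightarrow> F (X,y,z) = 0 \<and> F (-X,y,z) = 0"
  shows "integral (cbox (-X,-Y,-Z) (X,Y,Z)) F' = 0"
proof -
  have c2: "continuous_on (cbox (-X, (-Y,-Z)) (X, (Y,Z))) (\<lambda>(x,p). F' (x,p))"
    using c by simp
  have i0: "integral (cbox (-X) X) (\<lambda>x. F' (x,p)) = 0" if "p \<in> cbox (-Y,-Z) (Y,Z)" for p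
  proof -
    obtain y z where p: "p = (y,z)" by (cases p)
    have yz: "\<bar>y\<bar> \<le> Y" "\<bar>z\<bar> \<le> Z" using that p by auto
    have "((\<lambda>x. F' (x,y,z)) has_integral (F (X,y,z) - F (-X,y,z))) {-X..X}"
      by (rule fundamental_theorem_of_calculus)
        (use XY d in \<open>auto simp flip: has_real_derivative_iff_has_vector_derivative intro: DERIV_subset\<close>)
    then show ?thesis using b[OF yz] p by (simp add: integral_unique)
  qed
  have "integral (cbox (-X,-Y,-Z) (X,Y,Z)) F' =
      integral (cbox (-X) X) (\<lambda>x. integral (cbox (-Y,-Z) (Y,Z)) (\<lambda>p. F' (x,p)))"
    using integral_prod_continuous[OF c] .
  also have "\<dots> = integral (cbox (-Y,-Z) (Y,Z)) (\<lambda>p. integral (cbox (-X) X) (\<lambda>x. F' (x,p)))"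
    using integral_swap_continuous[OF c2] .
  also have "\<dots> = integral (cbox (-Y,-Z) (Y,Z)) (\<lambda>p. 0)"
    by (rule integral_cong) (use i0 in auto)
  finally show ?thesis by simp
qed

lemma integral_partial_y_zero:
  fixes F F' :: "real \<times> real \<times> real \<Rightarrow> real"
  assumes XY: "0 \<le> Y" and c: "continuous_on (cbox (-X,-Y,-Z) (X,Y,Z)) F'"
    and d: "\<And>x y z. ((\<lambda>y. F (x,y,z)) has_real_derivative F' (x,y,z)) (at y)"
    and b: "\<And>x z. \<bar>x\<bar> \<le> X \<Longrightarrow> \<bar>z\<bar> \<le> Z \<Longrightarrow> F (x,Y,z) = 0 \<and> F (x,-Y,z) = 0"
  shows "integral (cbox (-X,-Y,-Z) (X,Y,Z)) F' = 0"
proof -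
  have i0: "integral (cbox (-Y,-Z) (Y,Z)) (\<lambda>p. F' (x,p)) = 0" if x: "x \<in> cbox (-X) X" for x
  proof -
    have c1: "continuous_on (cbox (-Y,-Z) (Y,Z)) (\<lambda>p. F' (x,p))"
      by (rule continuous_on_compose2[OF c]) (use x in \<open>auto intro!: continuous_intros\<close>)
    then have c2: "continuous_on (cbox (-Y,-Z) (Y,Z)) (\<lambda>(y,z). F' (x,y,z))"
      by (simp add: case_prod_unfold)
    have j0: "integral (cbox (-Y) Y) (\<lambda>y. F' (x,y,z)) = 0" if "z \<in> cbox (-Z) Z" for z
    proof -
      have "((\<lambda>y. F' (x,y,z)) has_integral (F (x,Y,z) - F (x,-Y,z))) {-Y..Y}"
        by (rule fundamental_theorem_of_calculus)
          (use XY d in \<open>auto simp flip: has_real_derivative_iff_has_vector_derivative intro: DERIV_subset\<close>)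
      then show ?thesis using b[of x z] x that by (simp add: integral_unique abs_le_iff)
    qed
    have "integral (cbox (-Y,-Z) (Y,Z)) (\<lambda>p. F' (x,p)) =
        integral (cbox (-Y) Y) (\<lambda>y. integral (cbox (-Z) Z) (\<lambda>z. F' (x,y,z)))"
      using integral_prod_continuous[OF c1] .
    also have "\<dots> = integral (cbox (-Z) Z) (\<lambda>z. integral (cbox (-Y) Y) (\<lambda>y. F' (x,y,z)))"
      using integral_swap_continuous[OF c2] .
    also have "\<dots> = integral (cbox (-Z) Z) (\<lambda>p. 0)"
      by (rule integral_cong) (use j0 in auto)
    finally show ?thesis by simp
  qed
  have "integral (cbox (-X,-Y,-Z) (X,Y,Z)) F' =
      integral (cbox (-X) X) (\<lambda>x. integral (cbox (-Y,-Z) (Y,Z)) (\<lambda>p. F' (x,p)))"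
    using integral_prod_continuous[OF c] .
  also have "\<dots> = integral (cbox (-X) X) (\<lambda>x. 0)"
    by (rule integral_cong) (use i0 in auto)
  finally show ?thesis by simp
qed

lemma integral_partial_z_zero:
  fixes F F' :: "real \<times> real \<times> real \<Rightarrow> real"
  assumes XY: "0 \<le> Z" and c: "continuous_on (cbox (-X,-Y,-Z) (X,Y,Z)) F'"
    and d: "\<And>x y z. ((\<lambda>z. F (x,y,z)) has_real_derivative F' (x,y,z)) (at z)"
    and b: "\<And>x y. \<bar>x\<bar> \<le> X \<Longrightarrow> \<bar>y\<bar> \<le> Y \<Longrightarrow> F (x,y,Z) = 0 \<and> F (x,y,-Z) = 0"
  shows "integral (cbox (-X,-Y,-Z) (X,Y,Z)) F' = 0"
proof -
  have i0: "integral (cbox (-Y,-Z) (Y,Z)) (\<lambda>p. F' (x,p)) = 0" if x: "x \<in> cbox (-X) X" for x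
  proof -
    have c1: "continuous_on (cbox (-Y,-Z) (Y,Z)) (\<lambda>p. F' (x,p))"
      by (rule continuous_on_compose2[OF c]) (use x in \<open>auto intro!: continuous_intros\<close>)
    have j0: "integral (cbox (-Z) Z) (\<lambda>z. F' (x,y,z)) = 0" if "y \<in> cbox (-Y) Y" for y
    proof -
      have "((\<lambda>z. F' (x,y,z)) has_integral (F (x,y,Z) - F (x,y,-Z))) {-Z..Z}"
        by (rule fundamental_theorem_of_calculus)
          (use XY d in \<open>auto simp flip: has_real_derivative_iff_has_vector_derivative intro: DERIV_subset\<close>)
      then show ?thesis using b[of x y] x that by (simp add: integral_unique abs_le_iff)
    qed
    have "integral (cbox (-Y,-Z) (Y,Z)) (\<lambda>p. F' (x,p)) =
        integral (cbox (-Y) Y) (\<lambda>y. integral (cbox (-Z) Z) (\<lambda>z. F' (x,y,z)))"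
      using integral_prod_continuous[OF c1] .
    also have "\<dots> = integral (cbox (-Y) Y) (\<lambda>p. 0)"
      by (rule integral_cong) (use j0 in auto)
    finally show ?thesis by simp
  qed
  have "integral (cbox (-X,-Y,-Z) (X,Y,Z)) F' =
      integral (cbox (-X) X) (\<lambda>x. integral (cbox (-Y,-Z) (Y,Z)) (\<lambda>p. F' (x,p)))"
    using integral_prod_continuous[OF c] .
  also have "\<dots> = integral (cbox (-X) X) (\<lambda>x. 0)"
    by (rule integral_cong) (use i0 in auto)
  finally show ?thesis by simp
qed

section \<open>Functions with classical derivatives on time slabs\<close>

definition slab :: "real set \<Rightarrow> (real \<times> real \<times> real \<times> real) set" where
  "slab I = UNIV \<times> UNIV \<times> UNIV \<times> I"

lemma mem_slab [simp]: "(x, y, z, t) \<in> slab I \<longleftrightarrow> t \<in> I"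
  by (simp add: slab_def)

text \<open>The partial derivatives entering the Mumford operator are carried as explicit functions,
  jointly continuous on the slab. This is the form in which differentiation under the integral,
  Fubini and integration by parts all apply, and it fits smooth solutions as well as truncated
  weights, which have only finitely many derivatives.\<close>

definition classical_jet ::
  "real set \<Rightarrow> (real \<times> real \<times> real \<times> real \<Rightarrow> real) \<Rightarrow> (real \<times> real \<times> real \<times> real \<Rightarrow> real) \<Rightarrow>
   (real \<times> real \<times> real \<times> real \<Rightarrow> real) \<Rightarrow> (real \<times> real \<times> real \<times> real \<Rightarrow> real) \<Rightarrow>
   (real \<times> real \<times> real \<times> real \<Rightarrow> real) \<Rightarrow> (real \<times> real \<times> real \<times> real \<Rightarrow> real) \<Rightarrow> bool" where
  "classical_jet I f ft fx fxx fy fz \<longleftrightarrow>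
     continuous_on (slab I) f \<and> continuous_on (slab I) ft \<and> continuous_on (slab I) fx \<and>
     continuous_on (slab I) fxx \<and> continuous_on (slab I) fy \<and> continuous_on (slab I) fz \<and>
     (\<forall>x y z t. t \<in> I \<longrightarrow>
       ((\<lambda>s. f (x, y, z, s)) has_real_derivative ft (x, y, z, t)) (at t) \<and>
       ((\<lambda>s. f (s, y, z, t)) has_real_derivative fx (x, y, z, t)) (at x) \<and>
       ((\<lambda>s. fx (s, y, z, t)) has_real_derivative fxx (x, y, z, t)) (at x) \<and>
       ((\<lambda>s. f (x, s, z, t)) has_real_derivative fy (x, y, z, t)) (at y) \<and>
       ((\<lambda>s. f (x, y, s, t)) has_real_derivative fz (x, y, z, t)) (at z))"

lemma classical_jetD:
  assumes "classical_jet I f ft fx fxx fy fz" "t \<in> I"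
  shows "((\<lambda>s. f (x, y, z, s)) has_real_derivative ft (x, y, z, t)) (at t)"
    "((\<lambda>s. f (s, y, z, t)) has_real_derivative fx (x, y, z, t)) (at x)"
    "((\<lambda>s. fx (s, y, z, t)) has_real_derivative fxx (x, y, z, t)) (at x)"
    "((\<lambda>s. f (x, s, z, t)) has_real_derivative fy (x, y, z, t)) (at y)"
    "((\<lambda>s. f (x, y, s, t)) has_real_derivative fz (x, y, z, t)) (at z)"
  using assms unfolding classical_jet_def by auto

lemma classical_jet_continuous:
  assumes "classical_jet I f ft fx fxx fy fz"
  shows "continuous_on (slab I) f" "continuous_on (slab I) ft" "continuous_on (slab I) fx"
    "continuous_on (slab I) fxx" "continuous_on (slab I) fy" "continuous_on (slab I) fz"
  using assms unfolding classical_jet_def by auto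

lemma classical_jet_mono:
  assumes "classical_jet I f ft fx fxx fy fz" "J \<subseteq> I"
  shows "classical_jet J f ft fx fxx fy fz"
proof -
  have "slab J \<subseteq> slab I" using assms(2) by (auto simp: slab_def)
  then show ?thesis
    using assms unfolding classical_jet_def by (auto intro: continuous_on_subset)
qed

lemma continuous_on_slab_slice:
  fixes f :: "real \<times> real \<times> real \<times> real \<Rightarrow> real"
  assumes "continuous_on (slab I) f" "t \<in> I"
  shows "continuous_on A (\<lambda>p. f (fst p, fst (snd p), snd (snd p), t))"
  by (rule continuous_on_compose2[OF assms(1)]) (use assms(2) in \<open>auto intro!: continuous_intros\<close>)

lemma continuous_on_slab_swap:
  fixes f :: "real \<times> real \<times> real \<times> real \<Rightarrow> real"
  assumes "continuous_on (slab I) f"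
  shows "continuous_on (I \<times> A) (\<lambda>(t, p). f (fst p, fst (snd p), snd (snd p), t))"
  unfolding case_prod_unfold
  by (rule continuous_on_compose2[OF assms(1)]) (auto intro!: continuous_intros)

text \<open>Differentiate under the integral, then integrate by parts: twice in \<open>x\<close>,
  which is why both \<open>w\<close> and \<open>wx\<close> must vanish on the faces
  \<open>\<bar>x\<bar> = X\<close>, and once in \<open>y\<close> and \<open>z\<close>. The
  coefficients \<open>cos x\<close> and \<open>sin x\<close> are constant in \<open>y\<close> and
  \<open>z\<close>, so moving the drift onto \<open>w\<close> produces no zeroth-order term.\<close>

lemma mumford_green_identity:
  fixes X Y :: real
  assumes f: "classical_jet I f ft fx fxx fy fz"
    and w: "classical_jet I w wt wx wxx wy wz"
    and I: "open I" "convex I" "t \<in> I" and XY: "0 \<le> X" "0 \<le> Y"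
    and bx: "\<And>x y z. \<bar>x\<bar> = X \<Longrightarrow> w (x,y,z,t) = 0 \<and> wx (x,y,z,t) = 0"
    and byz: "\<And>x y z. \<bar>y\<bar> = Y \<or> \<bar>z\<bar> = Y \<Longrightarrow> w (x,y,z,t) = 0"
  shows "((\<lambda>t. integral (cbox (-X,-Y,-Y) (X,Y,Y)) (\<lambda>(x,y,z). w (x,y,z,t) * f (x,y,z,t)))
     has_real_derivative
       integral (cbox (-X,-Y,-Y) (X,Y,Y)) (\<lambda>(x,y,z).
         (wt (x,y,z,t) + wxx (x,y,z,t) - cos x * wy (x,y,z,t) - sin x * wz (x,y,z,t)) * f (x,y,z,t)
         + w (x,y,z,t) * (ft (x,y,z,t) - fxx (x,y,z,t) - cos x * fy (x,y,z,t) - sin x * fz (x,y,z,t))))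
     (at t)"
proof -
  let ?B = "cbox (-X,-Y,-Y) (X,Y,Y)"
  note cf = classical_jet_continuous[OF f] and cw = classical_jet_continuous[OF w]
  define sl where "sl q t p = (q (fst p, fst (snd p), snd (snd p), t) :: real)"
    for q :: "real \<times> real \<times> real \<times> real \<Rightarrow> real" and t p
  have sl_app: "sl q t (x,y,z) = q (x,y,z,t)" for q t x y z by (simp add: sl_def)
  have cat: "continuous_on A (sl q t)" if "continuous_on (slab I) q" for q A
    unfolding sl_def by (rule continuous_on_slab_slice[OF that I(3)])
  have catI: "continuous_on (I \<times> A) (\<lambda>x. sl q (fst x) (snd x))" if "continuous_on (slab I) q" for q A
    unfolding sl_def using continuous_on_slab_swap[OF that, of A] by (simp add: case_prod_unfold)
  have c: "continuous_on A (sl f t)" "continuous_on A (sl ft t)" "continuous_on A (sl fx t)"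
     "continuous_on A (sl fxx t)" "continuous_on A (sl fy t)" "continuous_on A (sl fz t)"
     "continuous_on A (sl w t)" "continuous_on A (sl wt t)" "continuous_on A (sl wx t)"
     "continuous_on A (sl wxx t)" "continuous_on A (sl wy t)" "continuous_on A (sl wz t)" for A
    using cf cw by (auto intro!: cat)
  define P where "P = (\<lambda>p. sl wt t p * sl f t p + sl ft t p * sl w t p)"
  have deriv: "((\<lambda>t. integral ?B (\<lambda>p. sl w t p * sl f t p)) has_real_derivative integral ?B P) (at t within I)"
    unfolding P_def
  proof (rule leibniz_rule_field_derivative[where f="\<lambda>s p. sl w s p * sl f s p"
          and fx="\<lambda>s p. sl wt s p * sl f s p + sl ft s p * sl w s p"])
    show "((\<lambda>t. sl w t p * sl f t p) has_real_derivative sl wt s p * sl f s p + sl ft s p * sl w s p) (at s within I)"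
      if "s \<in> I" "p \<in> ?B" for s p
    proof -
      have "((\<lambda>t. sl w t p) has_real_derivative sl wt s p) (at s within I)"
        "((\<lambda>t. sl f t p) has_real_derivative sl ft s p) (at s within I)"
        unfolding sl_def by (rule has_field_derivative_at_within, rule classical_jetD(1), rule w f, rule that)+
      from DERIV_mult[OF this] show ?thesis by (rule DERIV_cong) (rule refl)
    qed
    show "(\<lambda>p. sl w s p * sl f s p) integrable_on ?B" if "s \<in> I" for s
      unfolding sl_def
      by (intro integrable_continuous continuous_on_mult continuous_on_slab_slice[OF _ that] cf cw)
    show "continuous_on (I \<times> ?B) (\<lambda>(s, p). sl wt s p * sl f s p + sl ft s p * sl w s p)"
      unfolding case_prod_unfold by (intro continuous_on_add continuous_on_mult catI cf cw)
  qed (use I in auto)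
  \<comment> \<open>\<open>Q1\<close>, \<open>Q2\<close> and \<open>Q3\<close> are exact derivatives
    in \<open>x\<close>, \<open>y\<close> and \<open>z\<close> of quantities vanishing on the
    matching faces, so each integrates to 0. Subtracting them from the Leibniz integrand
    \<open>P\<close> moves the spatial derivatives into the adjoint form.\<close>
  define Q1 where "Q1 = (\<lambda>p. sl w t p * sl fxx t p - sl wxx t p * sl f t p)"
  define Q2 where "Q2 = (\<lambda>p. cos (fst p) * (sl wy t p * sl f t p + sl w t p * sl fy t p))"
  define Q3 where "Q3 = (\<lambda>p. sin (fst p) * (sl wz t p * sl f t p + sl w t p * sl fz t p))"
  have cQ: "continuous_on A Q1" "continuous_on A Q2" "continuous_on A Q3" "continuous_on A P" for A
    unfolding Q1_def Q2_def Q3_def P_def by (auto intro!: continuous_intros c)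
  have 1: "integral ?B Q1 = 0"
  proof (rule integral_partial_x_zero[where F="\<lambda>p. sl w t p * sl fx t p - sl wx t p * sl f t p"])
    show "((\<lambda>x. sl w t (x, y, z) * sl fx t (x, y, z) - sl wx t (x, y, z) * sl f t (x, y, z))
       has_real_derivative Q1 (x, y, z)) (at x)" for x y z
      using DERIV_diff[OF DERIV_mult[OF classical_jetD(2)[OF w I(3)] classical_jetD(3)[OF f I(3)]]
          DERIV_mult[OF classical_jetD(3)[OF w I(3)] classical_jetD(2)[OF f I(3)]]]
      unfolding Q1_def sl_app by (rule DERIV_cong) (simp add: algebra_simps)
  qed (use XY cQ bx in \<open>auto simp: sl_app\<close>)
  have 2: "integral ?B Q2 = 0"
  proof (rule integral_partial_y_zero[where F="\<lambda>p. cos (fst p) * (sl w t p * sl f t p)"])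
    show "((\<lambda>y. cos (fst (x, y, z)) * (sl w t (x, y, z) * sl f t (x, y, z)))
       has_real_derivative Q2 (x, y, z)) (at y)" for x y z
      using DERIV_cmult[OF DERIV_mult[OF classical_jetD(4)[OF w I(3)] classical_jetD(4)[OF f I(3)]], of "cos x"]
      unfolding Q2_def sl_app fst_conv by (rule DERIV_cong) (simp add: algebra_simps)
  qed (use XY cQ byz in \<open>auto simp: sl_app\<close>)
  have 3: "integral ?B Q3 = 0"
  proof (rule integral_partial_z_zero[where F="\<lambda>p. sin (fst p) * (sl w t p * sl f t p)"])
    show "((\<lambda>z. sin (fst (x, y, z)) * (sl w t (x, y, z) * sl f t (x, y, z)))
       has_real_derivative Q3 (x, y, z)) (at z)" for x y z
      using DERIV_cmult[OF DERIV_mult[OF classical_jetD(5)[OF w I(3)] classical_jetD(5)[OF f I(3)]], of "sin x"]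
      unfolding Q3_def sl_app fst_conv by (rule DERIV_cong) (simp add: algebra_simps)
  qed (use XY cQ byz in \<open>auto simp: sl_app\<close>)
  have "integral ?B P = integral ?B (\<lambda>p. P p - Q1 p - Q2 p - Q3 p)"
    using cQ[of ?B] 1 2 3 by (simp add: integral_diff integrable_continuous integrable_diff)
  also have "(\<lambda>p. P p - Q1 p - Q2 p - Q3 p) = (\<lambda>(x,y,z).
         (wt (x,y,z,t) + wxx (x,y,z,t) - cos x * wy (x,y,z,t) - sin x * wz (x,y,z,t)) * f (x,y,z,t)
         + w (x,y,z,t) * (ft (x,y,z,t) - fxx (x,y,z,t) - cos x * fy (x,y,z,t) - sin x * fz (x,y,z,t)))"
    unfolding P_def Q1_def Q2_def Q3_def by (auto simp: fun_eq_iff sl_app algebra_simps)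
  finally show ?thesis
    using deriv I by (simp add: at_within_open[OF I(3,1)] sl_def case_prod_unfold)
qed

subsection \<open>Truncated kernels\<close>

text \<open>With an exponent of at least two the kink of the positive part at 0 is smoothed out, and
  each differentiation lowers the exponent by one.\<close>

lemma DERIV_pos_part_power:
  fixes r :: real
  shows "((\<lambda>r. (max 0 r) ^ Suc (Suc n)) has_real_derivative real (Suc (Suc n)) * (max 0 r) ^ Suc n) (at r)"
proof -
  consider "r > 0" | "r < 0" | "r = 0" by linarith
  then show ?thesis
  proof cases
    case 1
    have "((\<lambda>r. r ^ Suc (Suc n)) has_real_derivative real (Suc (Suc n)) * (max 0 r) ^ Suc n) (at r)"
      using 1 DERIV_pow[of "Suc (Suc n)" r] by (simp add: max_def)
    then show ?thesis
      by (rule has_field_derivative_transform_within_open[where S="{0<..}"]) (use 1 in \<open>auto simp: max_def\<close>)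
  next
    case 2
    have "((\<lambda>r. 0) has_real_derivative real (Suc (Suc n)) * (max 0 r) ^ Suc n) (at r)"
      using 2 by (simp add: max_def)
    then show ?thesis
      by (rule has_field_derivative_transform_within_open[where S="{..<0}"]) (use 2 in \<open>auto simp: max_def\<close>)
  next
    case 3
    \<comment> \<open>Caratheodory's criterion at the kink: the slope function is
      \<open>(max 0 z) ^ Suc n\<close>, continuous with value 0 at 0.\<close>
    have "\<exists>g. (\<forall>z. (max 0 z) ^ Suc (Suc n) - (max 0 (0::real)) ^ Suc (Suc n) = g z * (z - 0)) \<and>
        isCont g 0 \<and> g 0 = 0"
    proof (intro exI[of _ "\<lambda>z. (max 0 z) ^ Suc n"] conjI allI)
      show "(max 0 z) ^ Suc (Suc n) - (max 0 (0::real)) ^ Suc (Suc n) = (max 0 z) ^ Suc n * (z - 0)" for z :: real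
        by (auto simp: max_def)
    qed (auto intro!: continuous_intros)
    then show ?thesis using 3 by (simp add: CARAT_DERIV)
  qed
qed

lemma DERIV_pos_part_square_chain:
  fixes f :: "real \<Rightarrow> real"
  assumes "(f has_real_derivative D) (at x)"
  shows "((\<lambda>x. (max 0 (f x))\<^sup>2) has_real_derivative 2 * max 0 (f x) * D) (at x)"
  using DERIV_chain2[OF DERIV_pos_part_power[of 0 "f x"] assms] by (simp add: numeral_2_eq_2)

lemma DERIV_pos_part_cube_chain:
  fixes f :: "real \<Rightarrow> real"
  assumes "(f has_real_derivative D) (at x)"
  shows "((\<lambda>x. (max 0 (f x)) ^ 3) has_real_derivative 3 * (max 0 (f x))\<^sup>2 * D) (at x)"
  using DERIV_chain2[OF DERIV_pos_part_power[of 1 "f x"] assms]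
  by (simp add: numeral_2_eq_2 numeral_3_eq_3)

text \<open>The cube root of the one-dimensional heat kernel, up to a constant.\<close>
definition root_kernel :: "real \<Rightarrow> real \<Rightarrow> real" where
  "root_kernel s x = exp (- ln s / 6 - x\<^sup>2 / (12 * s))"

lemma root_kernel_pos: "0 < root_kernel s x"
  by (simp add: root_kernel_def)

lemma DERIV_root_kernel_x:
  assumes "0 < s"
  shows "(root_kernel s has_real_derivative - x / (6 * s) * root_kernel s x) (at x)"
proof -
  have "((\<lambda>x. - ln s / 6 - 1 / (12 * s) * x\<^sup>2) has_real_derivative - x / (6 * s)) (at x)"
    by (rule DERIV_cong[OF DERIV_diff[OF DERIV_const DERIV_cmult[OF DERIV_pow]]]) simp
  from DERIV_chain2[OF DERIV_exp this] show ?thesis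
    unfolding root_kernel_def by (simp add: mult.commute)
qed

lemma DERIV_root_kernel_t:
  assumes "t < S"
  shows "((\<lambda>t. root_kernel (S - t) x) has_real_derivative
     (1 / (6 * (S - t)) - x\<^sup>2 / (12 * (S - t)\<^sup>2)) * root_kernel (S - t) x) (at t)"
proof -
  define s where "s = S - t"
  have s: "s > 0" using assms by (simp add: s_def)
  have "((\<lambda>s. - (1/6) * ln s - x\<^sup>2 / 12 * inverse s) has_real_derivative
      - (1/6) * (1 / s) - x\<^sup>2 / 12 * - (inverse s ^ Suc (Suc 0))) (at s)"
    by (intro DERIV_diff DERIV_cmult DERIV_ln_divide DERIV_inverse) (use s in auto)
  moreover have "(\<lambda>s. - (1/6) * ln s - x\<^sup>2 / 12 * inverse s) = (\<lambda>s. - ln s / 6 - x\<^sup>2 / (12 * s))"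
    by (simp add: fun_eq_iff inverse_eq_divide)
  moreover have "- (1/6) * (1 / s) - x\<^sup>2 / 12 * - (inverse s ^ Suc (Suc 0)) = x\<^sup>2 / (12 * s\<^sup>2) - 1 / (6 * s)"
    using s by (simp add: power2_eq_square inverse_eq_divide)
  ultimately have "((\<lambda>s. - ln s / 6 - x\<^sup>2 / (12 * s)) has_real_derivative
      (x\<^sup>2 / (12 * s\<^sup>2) - 1 / (6 * s))) (at s)" by (simp only:)
  from DERIV_chain2[OF DERIV_exp this]
  have "((\<lambda>s. root_kernel s x) has_real_derivative
      root_kernel s x * (x\<^sup>2 / (12 * s\<^sup>2) - 1 / (6 * s))) (at (S - t))"
    unfolding root_kernel_def s_def .
  from DERIV_chain2[OF this DERIV_diff[OF DERIV_const DERIV_ident]]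
  show ?thesis by (rule DERIV_cong) (simp add: s_def algebra_simps)
qed

definition x_cutoff :: "real \<Rightarrow> real \<Rightarrow> real \<Rightarrow> real \<Rightarrow> real" where
  "x_cutoff S \<epsilon> t x = max 0 (root_kernel (S - t) x - \<epsilon>)"

definition yz_cutoff :: "real \<Rightarrow> real \<Rightarrow> real \<Rightarrow> real \<Rightarrow> real \<Rightarrow> real" where
  "yz_cutoff a k t y z = max 0 ((a + k * t)\<^sup>2 - y\<^sup>2 - z\<^sup>2)"

text \<open>The powers match the operator: two derivatives in \<open>x\<close> call for a cube, one
  derivative in \<open>y\<close>, \<open>z\<close> and \<open>t\<close> for a square. The cutoff in
  \<open>(y, z)\<close> lives on a disc of radius \<open>a + k * t\<close>; below, \<open>k\<close>
  is 1 (growing disc) or -1 (shrinking disc), matching the unit speed of the drift.\<close>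

definition weight :: "real \<Rightarrow> real \<Rightarrow> real \<Rightarrow> real \<Rightarrow> real \<times> real \<times> real \<times> real \<Rightarrow> real" where
  "weight S \<epsilon> a k = (\<lambda>(x,y,z,t). (x_cutoff S \<epsilon> t x) ^ 3 * (yz_cutoff a k t y z)\<^sup>2)"

definition weight_t where
  "weight_t S \<epsilon> a k = (\<lambda>(x,y,z,t::real).
     3 * (x_cutoff S \<epsilon> t x)\<^sup>2 * ((1 / (6 * (S - t)) - x\<^sup>2 / (12 * (S - t)\<^sup>2)) * root_kernel (S - t) x)
       * (yz_cutoff a k t y z)\<^sup>2
     + x_cutoff S \<epsilon> t x ^ 3 * (4 * k * (a + k * t) * yz_cutoff a k t y z))"

definition weight_x where
  "weight_x S \<epsilon> a k = (\<lambda>(x,y,z,t::real).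
     3 * (x_cutoff S \<epsilon> t x)\<^sup>2 * (- x / (6 * (S - t)) * root_kernel (S - t) x) * (yz_cutoff a k t y z)\<^sup>2)"

definition weight_xx where
  "weight_xx S \<epsilon> a k = (\<lambda>(x,y,z,t::real).
     (6 * x_cutoff S \<epsilon> t x * (- x / (6 * (S - t)) * root_kernel (S - t) x)\<^sup>2
      + 3 * (x_cutoff S \<epsilon> t x)\<^sup>2 * ((x\<^sup>2 / (36 * (S - t)\<^sup>2) - 1 / (6 * (S - t))) * root_kernel (S - t) x))
      * (yz_cutoff a k t y z)\<^sup>2)"

definition weight_y where
  "weight_y S \<epsilon> a k = (\<lambda>(x,y,z,t::real). x_cutoff S \<epsilon> t x ^ 3 * (- 4 * y * yz_cutoff a k t y z))"

definition weight_z where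
  "weight_z S \<epsilon> a k = (\<lambda>(x,y,z,t::real). x_cutoff S \<epsilon> t x ^ 3 * (- 4 * z * yz_cutoff a k t y z))"

lemmas weight_defs = weight_def weight_t_def weight_x_def weight_xx_def weight_y_def weight_z_def

lemma weight_nonneg: "0 \<le> weight S \<epsilon> a k p"
  by (cases p) (auto simp: weight_def x_cutoff_def intro!: mult_nonneg_nonneg)

lemma DERIV_x_cutoff_cube_x:
  assumes "t < S"
  shows "((\<lambda>x. x_cutoff S \<epsilon> t x ^ 3) has_real_derivative
     3 * (x_cutoff S \<epsilon> t x)\<^sup>2 * (- x / (6 * (S - t)) * root_kernel (S - t) x)) (at x)"
  unfolding x_cutoff_def
  by (rule DERIV_pos_part_cube_chain)
    (rule DERIV_cong[OF DERIV_diff[OF DERIV_root_kernel_x DERIV_const]], use assms in auto)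

lemma DERIV_x_cutoff_square_x:
  assumes "t < S"
  shows "((\<lambda>x. (x_cutoff S \<epsilon> t x)\<^sup>2) has_real_derivative
     2 * x_cutoff S \<epsilon> t x * (- x / (6 * (S - t)) * root_kernel (S - t) x)) (at x)"
  unfolding x_cutoff_def
  by (rule DERIV_pos_part_square_chain)
    (rule DERIV_cong[OF DERIV_diff[OF DERIV_root_kernel_x DERIV_const]], use assms in auto)

lemma DERIV_x_cutoff_cube_t:
  assumes "t < S"
  shows "((\<lambda>t. x_cutoff S \<epsilon> t x ^ 3) has_real_derivative
     3 * (x_cutoff S \<epsilon> t x)\<^sup>2 * ((1 / (6 * (S - t)) - x\<^sup>2 / (12 * (S - t)\<^sup>2)) * root_kernel (S - t) x)) (at t)"
  unfolding x_cutoff_def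
  by (rule DERIV_pos_part_cube_chain)
    (rule DERIV_cong[OF DERIV_diff[OF DERIV_root_kernel_t DERIV_const]], use assms in auto)

lemma DERIV_yz_cutoff_square:
  "((\<lambda>t. (yz_cutoff a k t y z)\<^sup>2) has_real_derivative 4 * k * (a + k * t) * yz_cutoff a k t y z) (at t)"
  "((\<lambda>y. (yz_cutoff a k t y z)\<^sup>2) has_real_derivative - 4 * y * yz_cutoff a k t y z) (at y)"
  "((\<lambda>z. (yz_cutoff a k t y z)\<^sup>2) has_real_derivative - 4 * z * yz_cutoff a k t y z) (at z)"
  unfolding yz_cutoff_def
  by (rule DERIV_cong[OF DERIV_pos_part_square_chain], (rule derivative_eq_intros refl)+, simp)+

lemma weight_jet:
  assumes I: "I \<subseteq> {..<S}"
  shows "classical_jet I (weight S \<epsilon> a k) (weight_t S \<epsilon> a k) (weight_x S \<epsilon> a k) (weight_xx S \<epsilon> a k)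
    (weight_y S \<epsilon> a k) (weight_z S \<epsilon> a k)"
proof -
  have neq: "S - snd (snd (snd p)) \<noteq> 0" if "p \<in> slab I" for p :: "real \<times> real \<times> real \<times> real"
    using that I by (cases p) auto
  have rk: "continuous_on (slab I) (\<lambda>p. root_kernel (S - snd (snd (snd p))) (fst p))"
    unfolding root_kernel_def by (intro continuous_intros) (use neq in auto)
  then have xc: "continuous_on (slab I) (\<lambda>p. x_cutoff S \<epsilon> (snd (snd (snd p))) (fst p))"
    unfolding x_cutoff_def by (intro continuous_intros)
  have yc: "continuous_on (slab I) (\<lambda>p. yz_cutoff a k (snd (snd (snd p))) (fst (snd p)) (fst (snd (snd p))))"
    unfolding yz_cutoff_def by (intro continuous_intros)
  have "continuous_on (slab I) (weight S \<epsilon> a k)" "continuous_on (slab I) (weight_t S \<epsilon> a k)"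
    "continuous_on (slab I) (weight_x S \<epsilon> a k)" "continuous_on (slab I) (weight_xx S \<epsilon> a k)"
    "continuous_on (slab I) (weight_y S \<epsilon> a k)" "continuous_on (slab I) (weight_z S \<epsilon> a k)"
    unfolding weight_defs case_prod_unfold
    by (intro continuous_intros rk xc yc; use neq in auto)+
  moreover {
    fix x y z t assume "t \<in> I"
    then have t: "t < S" using I by auto
    have "((\<lambda>s. weight S \<epsilon> a k (x, y, z, s)) has_real_derivative weight_t S \<epsilon> a k (x, y, z, t)) (at t)"
      unfolding weight_defs case_prod_conv
      by (rule DERIV_cong[OF DERIV_mult[OF DERIV_x_cutoff_cube_t[OF t] DERIV_yz_cutoff_square(1)]]) simp
    moreover have "((\<lambda>s. weight S \<epsilon> a k (s, y, z, t)) has_real_derivative weight_x S \<epsilon> a k (x, y, z, t)) (at x)"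
      unfolding weight_defs case_prod_conv
      by (rule DERIV_cong[OF DERIV_mult[OF DERIV_x_cutoff_cube_x[OF t] DERIV_const]]) simp
    moreover have "((\<lambda>s. weight_x S \<epsilon> a k (s, y, z, t)) has_real_derivative weight_xx S \<epsilon> a k (x, y, z, t)) (at x)"
    proof -
      have "((\<lambda>x. - x / (6 * (S - t)) * root_kernel (S - t) x) has_real_derivative
          (x\<^sup>2 / (36 * (S - t)\<^sup>2) - 1 / (6 * (S - t))) * root_kernel (S - t) x) (at x)"
        by (rule DERIV_cong[OF DERIV_mult[OF DERIV_cdivide[OF DERIV_minus[OF DERIV_ident]] DERIV_root_kernel_x]])
          (use t in \<open>simp_all add: algebra_simps power2_eq_square\<close>)
      note * = DERIV_mult[OF DERIV_mult[OF DERIV_cmult[OF DERIV_x_cutoff_square_x[OF t, of \<epsilon> x], of 3] this] DERIV_const]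
      show ?thesis
        unfolding weight_defs case_prod_conv
        by (rule DERIV_cong[OF *]) (simp add: algebra_simps power2_eq_square)
    qed
    moreover have "((\<lambda>s. weight S \<epsilon> a k (x, s, z, t)) has_real_derivative weight_y S \<epsilon> a k (x, y, z, t)) (at y)"
      unfolding weight_defs case_prod_conv
      by (rule DERIV_cong[OF DERIV_cmult[OF DERIV_yz_cutoff_square(2)]]) simp
    moreover have "((\<lambda>s. weight S \<epsilon> a k (x, y, s, t)) has_real_derivative weight_z S \<epsilon> a k (x, y, z, t)) (at z)"
      unfolding weight_defs case_prod_conv
      by (rule DERIV_cong[OF DERIV_cmult[OF DERIV_yz_cutoff_square(3)]]) simp
    moreover note calculation
  }
  ultimately show ?thesis unfolding classical_jet_def by blast
qed

text \<open>Without truncation the cube of the kernel solves the backward heat equation exactly, so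
  only an error proportional to \<epsilon> remains from the \<open>x\<close>-factor. The other term
  comes from differentiating the disc cutoff along the drift; its sign is decided by
  \<open>k\<close>.\<close>

lemma adjoint_weight:
  assumes "t < S"
  shows "weight_t S \<epsilon> a k (x,y,z,t) + weight_xx S \<epsilon> a k (x,y,z,t)
      - cos x * weight_y S \<epsilon> a k (x,y,z,t) - sin x * weight_z S \<epsilon> a k (x,y,z,t) =
    \<epsilon> * x\<^sup>2 / (6 * (S - t)\<^sup>2) * x_cutoff S \<epsilon> t x * root_kernel (S - t) x * (yz_cutoff a k t y z)\<^sup>2
    + 4 * x_cutoff S \<epsilon> t x ^ 3 * yz_cutoff a k t y z * (k * (a + k * t) + y * cos x + z * sin x)"
proof -
  define s where "s = S - t"
  define m where "m = x_cutoff S \<epsilon> t x"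
  define g where "g = root_kernel s x"
  define q where "q = yz_cutoff a k t y z"
  have s: "s \<noteq> 0" using assms by (simp add: s_def)
  \<comment> \<open>On the support of \<open>m\<close> one has \<open>g - m = \<epsilon>\<close>,
    and elsewhere \<open>m = 0\<close>. This identity is where the factor \<epsilon> in the error
    arises.\<close>
  have mg: "m * (g - m) = m * \<epsilon>"
    by (auto simp: m_def g_def x_cutoff_def s_def max_def)
  have "3 * m\<^sup>2 * ((1 / (6 * s) - x\<^sup>2 / (12 * s\<^sup>2)) * g) +
     (6 * m * (- x / (6 * s) * g)\<^sup>2 + 3 * m\<^sup>2 * ((x\<^sup>2 / (36 * s\<^sup>2) - 1 / (6 * s)) * g))
     = x\<^sup>2 / (6 * s\<^sup>2) * g * (m * (g - m))"
    using s by (simp add: field_simps power2_eq_square)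
  also have "\<dots> = \<epsilon> * x\<^sup>2 / (6 * s\<^sup>2) * m * g"
    by (simp add: mg)
  finally have "(3 * m\<^sup>2 * ((1 / (6 * s) - x\<^sup>2 / (12 * s\<^sup>2)) * g) +
     (6 * m * (- x / (6 * s) * g)\<^sup>2 + 3 * m\<^sup>2 * ((x\<^sup>2 / (36 * s\<^sup>2) - 1 / (6 * s)) * g))) * q\<^sup>2
     = \<epsilon> * x\<^sup>2 / (6 * s\<^sup>2) * m * g * q\<^sup>2" by simp
  then show ?thesis
    unfolding weight_defs case_prod_conv s_def[symmetric] m_def[symmetric] g_def[symmetric] q_def[symmetric]
    by (simp add: algebra_simps)
qed

text \<open>\<open>y * cos x + z * sin x\<close> and \<open>y * sin x - z * cos x\<close> are the
  coordinates of \<open>(y, z)\<close> in a rotated frame, so their squares add up to the squared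
  norm.\<close>

lemma rotation_bound:
  fixes x y z :: real
  shows "\<bar>y * cos x + z * sin x\<bar> \<le> sqrt (y\<^sup>2 + z\<^sup>2)"
proof -
  have "(y * cos x + z * sin x)\<^sup>2 + (y * sin x - z * cos x)\<^sup>2 = (y\<^sup>2 + z\<^sup>2) * ((sin x)\<^sup>2 + (cos x)\<^sup>2)"
    by (simp only: power2_eq_square) algebra
  then have "(y * cos x + z * sin x)\<^sup>2 \<le> y\<^sup>2 + z\<^sup>2"
    by (smt (verit) zero_le_power2 sin_cos_squared_add mult_cancel_left2)
  then show ?thesis by (metis real_sqrt_abs real_sqrt_le_iff)
qed

text \<open>On the support of the disc cutoff \<open>(y, z)\<close> has norm at most the radius.
  Hence the bracket \<open>k * (a + k * t) + y * cos x + z * sin x\<close> of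
  \<open>adjoint_weight\<close> is nonnegative there for \<open>k = 1\<close> and nonpositive for
  \<open>k = -1\<close>.\<close>

lemma drift_bound:
  assumes "yz_cutoff a k t y z \<noteq> 0" "0 \<le> a + k * t"
  shows "\<bar>y * cos x + z * sin x\<bar> \<le> a + k * t"
proof -
  have "y\<^sup>2 + z\<^sup>2 \<le> (a + k * t)\<^sup>2"
    using assms(1) by (auto simp: yz_cutoff_def max_def split: if_splits)
  then have "sqrt (y\<^sup>2 + z\<^sup>2) \<le> a + k * t"
    using assms(2) real_le_lsqrt by blast
  then show ?thesis using rotation_bound[of y x z] by linarith
qed

text \<open>\<open>root_kernel s x ^ 3 = exp (- x\<^sup>2 / (4 s)) / sqrt s\<close>, and \<open>exp (- r) \<le> 1 / (1 + r)\<close>.\<close>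
lemma root_kernel_cube_le:
  assumes "0 < s"
  shows "root_kernel s x ^ 3 \<le> 1 / (sqrt s * (1 + (x / (2 * sqrt s))\<^sup>2))"
proof -
  have "root_kernel s x ^ 3 = exp (- ln s / 2) * exp (- (x\<^sup>2 / (4 * s)))"
    unfolding root_kernel_def by (simp add: exp_of_nat_mult[symmetric] exp_add[symmetric] field_simps)
  also have "exp (- ln s / 2) = 1 / sqrt s"
    using assms by (simp add: exp_minus ln_sqrt[symmetric] inverse_eq_divide)
  also have "exp (- (x\<^sup>2 / (4 * s))) \<le> 1 / (1 + x\<^sup>2 / (4 * s))"
    using exp_ge_add_one_self[of "x\<^sup>2 / (4 * s)"] assms
    by (simp add: exp_minus inverse_eq_divide add_pos_nonneg frac_le)
  finally show ?thesis using assms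
    by (simp add: power_divide power_mult_distrib mult_left_mono divide_simps)
qed

subsection \<open>Derivatives of smooth solutions\<close>

lemma differentiable_along_curve:
  fixes f :: "'a::real_normed_vector \<Rightarrow> real"
  assumes "f differentiable (at (c s))" "(c has_vector_derivative v) (at s)"
  shows "((\<lambda>s. f (c s)) has_real_derivative frechet_derivative f (at (c s)) v) (at s)"
proof -
  have "(f has_derivative frechet_derivative f (at (c s))) (at (c s) within range c)"
    using assms(1) by (simp add: frechet_derivative_works has_derivative_at_withinI)
  from vector_derivative_diff_chain_within[OF assms(2) this]
  show ?thesis by (simp add: has_real_derivative_iff_has_vector_derivative o_def)
qed

text \<open>The partial derivatives are Frechet derivatives in coordinate directions, so two levels
  of smoothness give the whole jet. This translates the operator from \<open>deriv\<close> to
  explicit functions, up to a real time \<open>b\<close> even when \<open>T\<close> is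
  infinite.\<close>

lemma Cinf_on_jet:
  assumes u: "Cinf_on u (open_strip T)" and b: "ereal b \<le> T"
  shows "\<exists>ut ux uxx uy uz. classical_jet {0<..<b} u ut ux uxx uy uz \<and>
    (\<forall>x y z t. 0 < t \<longrightarrow> t < b \<longrightarrow> mumford u (x,y,z,t) =
       ut (x,y,z,t) - cos x * uy (x,y,z,t) - sin x * uz (x,y,z,t) - uxx (x,y,z,t))"
proof -
  have sub: "slab {0<..<b} \<subseteq> open_strip T"
  proof
    fix p :: "real \<times> real \<times> real \<times> real" assume p: "p \<in> slab {0<..<b}"
    obtain x y z t where [simp]: "p = (x,y,z,t)" by (cases p)
    have "ereal t < T" using p b less_le_trans[of "ereal t" "ereal b" T] by simp
    with p show "p \<in> open_strip T" by (auto simp: open_strip_def)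
  qed
  define D where "D v p = frechet_derivative u (at p) v" for v p
  have De: "(\<lambda>p. frechet_derivative u (at p) v) = D v" for v by (auto simp: D_def)
  have "Ck_on (Suc (Suc 0)) u (open_strip T)" using u unfolding Cinf_on_def by blast
  note C2 = this[unfolded Ck_on.simps De]
  have du: "u differentiable (at p)" and dD: "D v differentiable (at p)" if "p \<in> open_strip T" for p v
    using that C2 by blast+
  have cDD: "continuous_on (open_strip T) (\<lambda>p. frechet_derivative (D v) (at p) v')" for v v'
    using C2 by blast
  have cu: "continuous_on (open_strip T) u"
    using u unfolding Cinf_on_def by (metis Ck_on.simps(1))
  have cD: "continuous_on (open_strip T) (D v)" for v
    using dD by (meson continuous_at_imp_continuous_on differentiable_imp_continuous_within)
  define uxx where "uxx = (\<lambda>p. frechet_derivative (D (1,0,0,0)) (at p) (1,0,0,0))"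
  have cv: "((\<lambda>s. (s,y,z,t)) has_vector_derivative (1,0,0,0)) (at r)"
    "((\<lambda>s. (x,s,z,t)) has_vector_derivative (0,1,0,0)) (at r)"
    "((\<lambda>s. (x,y,s,t)) has_vector_derivative (0,0,1,0)) (at r)"
    "((\<lambda>s. (x,y,z,s)) has_vector_derivative (0,0,0,1)) (at r)" for x y z t r :: real
    by (auto intro!: has_vector_derivative_Pair has_vector_derivative_const has_vector_derivative_id[unfolded id_def]
        simp: zero_prod_def[symmetric])
  have P: "((\<lambda>s. u (x, y, z, s)) has_real_derivative D (0,0,0,1) (x, y, z, t)) (at t)"
    "((\<lambda>s. u (s, y, z, t)) has_real_derivative D (1,0,0,0) (x, y, z, t)) (at x)"
    "((\<lambda>s. D (1,0,0,0) (s, y, z, t)) has_real_derivative uxx (x, y, z, t)) (at x)"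
    "((\<lambda>s. u (x, s, z, t)) has_real_derivative D (0,1,0,0) (x, y, z, t)) (at y)"
    "((\<lambda>s. u (x, y, s, t)) has_real_derivative D (0,0,1,0) (x, y, z, t)) (at z)"
    if "t \<in> {0<..<b}" for x y z t
  proof -
    have p: "(x,y,z,t) \<in> open_strip T" using sub that by auto
    show "((\<lambda>s. u (x, y, z, s)) has_real_derivative D (0,0,0,1) (x, y, z, t)) (at t)"
      "((\<lambda>s. u (s, y, z, t)) has_real_derivative D (1,0,0,0) (x, y, z, t)) (at x)"
      "((\<lambda>s. D (1,0,0,0) (s, y, z, t)) has_real_derivative uxx (x, y, z, t)) (at x)"
      "((\<lambda>s. u (x, s, z, t)) has_real_derivative D (0,1,0,0) (x, y, z, t)) (at y)"
      "((\<lambda>s. u (x, y, s, t)) has_real_derivative D (0,0,1,0) (x, y, z, t)) (at z)"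
      using differentiable_along_curve[OF _ cv(4)[of x y z t], of u]
        differentiable_along_curve[OF _ cv(1)[of y z t x], of u]
        differentiable_along_curve[OF _ cv(1)[of y z t x], of "D (1,0,0,0)"]
        differentiable_along_curve[OF _ cv(2)[of x z t y], of u]
        differentiable_along_curve[OF _ cv(3)[of x y t z], of u] du[OF p] dD[OF p]
      unfolding D_def uxx_def by blast+
  qed
  have "classical_jet {0<..<b} u (D (0,0,0,1)) (D (1,0,0,0)) uxx (D (0,1,0,0)) (D (0,0,1,0))"
    unfolding classical_jet_def
    using P cu[THEN continuous_on_subset, OF sub] cD[THEN continuous_on_subset, OF sub]
      cDD[of "(1,0,0,0)" "(1,0,0,0)", THEN continuous_on_subset, OF sub]
    by (auto simp: uxx_def)
  moreover have "mumford u (x,y,z,t) =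
       D (0,0,0,1) (x,y,z,t) - cos x * D (0,1,0,0) (x,y,z,t) - sin x * D (0,0,1,0) (x,y,z,t) - uxx (x,y,z,t)"
    if t: "0 < t" "t < b" for x y z t
  proof -
    have t': "t \<in> {0<..<b}" using t by simp
    \<comment> \<open>The whole line through the point parallel to the \<open>x\<close>-axis stays
      in the strip, so the first derivative is identified as a function and the iterated
      \<open>deriv\<close> can be evaluated.\<close>
    have "deriv (\<lambda>s. u (s,y,z,t)) = (\<lambda>s. D (1,0,0,0) (s,y,z,t))"
      using DERIV_imp_deriv[OF P(2)[OF t']] by auto
    then show ?thesis
      unfolding mumford_def
      by (simp add: DERIV_imp_deriv[OF P(1)[OF t']] DERIV_imp_deriv[OF P(3)[OF t']]
          DERIV_imp_deriv[OF P(4)[OF t']] DERIV_imp_deriv[OF P(5)[OF t']] numeral_2_eq_2)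
  qed
  ultimately show ?thesis by blast
qed

section \<open>Supports of the cutoffs and evolution of weighted integrals\<close>

lemma x_cutoff_eq_0:
  assumes "t < S" "0 < \<epsilon>" "4 * sqrt (S - t) \<le> \<epsilon> ^ 3 * x\<^sup>2"
  shows "x_cutoff S \<epsilon> t x = 0"
proof -
  define s where "s = S - t"
  have s: "0 < s" using assms by (simp add: s_def)
  have x: "0 < x\<^sup>2" using assms s by (auto simp: s_def)
  have "root_kernel s x ^ 3 \<le> 1 / (sqrt s * (1 + (x / (2 * sqrt s))\<^sup>2))"
    using root_kernel_cube_le[OF s] .
  \<comment> \<open>Dropping the summand 1 leaves \<open>4 * sqrt s / x\<^sup>2\<close>, which is at
    most \<open>\<epsilon> ^ 3\<close> by assumption. The threshold increases with \<open>s\<close>,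
    so one half-width \<open>X\<close> serves a whole range of times.\<close>
  also have "\<dots> \<le> 1 / (sqrt s * (x / (2 * sqrt s))\<^sup>2)"
    using s x by (intro divide_left_mono mult_left_mono mult_pos_pos) (auto intro!: add_pos_nonneg)
  also have "\<dots> = 4 * sqrt s / x\<^sup>2"
    using s x by (simp add: power_divide power_mult_distrib field_simps)
  also have "\<dots> \<le> \<epsilon> ^ 3"
    using assms(3) x by (simp add: s_def field_simps)
  finally have "root_kernel s x \<le> \<epsilon>"
    using assms(2) power_mono_iff[of "root_kernel s x" \<epsilon> 3] root_kernel_pos[of s x] by simp
  then show ?thesis by (simp add: x_cutoff_def s_def)
qed

lemma yz_cutoff_eq_0:
  assumes "0 \<le> a + k * t" "a + k * t \<le> Y" "Y \<le> \<bar>y\<bar> \<or> Y \<le> \<bar>z\<bar>"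
  shows "yz_cutoff a k t y z = 0"
proof -
  have "(a + k * t)\<^sup>2 \<le> y\<^sup>2 + z\<^sup>2"
    using assms(3)
  proof
    assume "Y \<le> \<bar>y\<bar>"
    then have "(a + k * t)\<^sup>2 \<le> \<bar>y\<bar>\<^sup>2" using assms by (intro power_mono) auto
    then show ?thesis by (simp add: add_increasing2)
  next
    assume "Y \<le> \<bar>z\<bar>"
    then have "(a + k * t)\<^sup>2 \<le> \<bar>z\<bar>\<^sup>2" using assms by (intro power_mono) auto
    then show ?thesis by (simp add: add_increasing)
  qed
  then show ?thesis by (simp add: yz_cutoff_def)
qed

text \<open>The box is large enough for the weight to vanish on its faces, so Green's identity
  applies; the adjoint operator on the weight is replaced by its closed form from
  \<open>adjoint_weight\<close>.\<close>

lemma cutoff_integral_has_derivative: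
  assumes f: "classical_jet I f ft fx fxx fy fz"
    and I: "open I" "convex I" "I \<subseteq> {..<S}" "t \<in> I"
    and \<epsilon>: "0 < \<epsilon>" and X: "0 \<le> X" "4 * sqrt (S - t) \<le> \<epsilon> ^ 3 * X\<^sup>2"
    and Y: "0 \<le> a + k * t" "a + k * t \<le> Y"
  shows "((\<lambda>t. integral (cbox (-X,-Y,-Y) (X,Y,Y)) (\<lambda>(x,y,z). weight S \<epsilon> a k (x,y,z,t) * f (x,y,z,t)))
     has_real_derivative
       integral (cbox (-X,-Y,-Y) (X,Y,Y)) (\<lambda>(x,y,z).
         (\<epsilon> * x\<^sup>2 / (6 * (S - t)\<^sup>2) * x_cutoff S \<epsilon> t x * root_kernel (S - t) x * (yz_cutoff a k t y z)\<^sup>2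
          + 4 * x_cutoff S \<epsilon> t x ^ 3 * yz_cutoff a k t y z * (k * (a + k * t) + y * cos x + z * sin x)) * f (x,y,z,t)
         + weight S \<epsilon> a k (x,y,z,t) *
           (ft (x,y,z,t) - fxx (x,y,z,t) - cos x * fy (x,y,z,t) - sin x * fz (x,y,z,t))))
     (at t)"
proof -
  have tS: "t < S" using I by auto
  have Y0: "0 \<le> Y" using Y by linarith
  have xc: "x_cutoff S \<epsilon> t x = 0" if "\<bar>x\<bar> = X" for x
    using x_cutoff_eq_0[OF tS \<epsilon>] X that by (metis power2_abs)
  show ?thesis
    unfolding adjoint_weight[OF tS, symmetric]
    by (rule mumford_green_identity[OF f weight_jet[OF I(3)] I(1,2,4) X(1) Y0])
      (auto simp: xc weight_def weight_x_def yz_cutoff_eq_0[OF Y])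
qed

subsection \<open>A weighted bound for nonnegative solutions\<close>

text \<open>For a nonintegrable function the bound holds because \<open>integral\<close> then has
  the default value 0.\<close>

lemma integral_nonneg_pointwise:
  fixes f :: "'a::euclidean_space \<Rightarrow> real"
  assumes "\<And>p. p \<in> A \<Longrightarrow> 0 \<le> f p"
  shows "0 \<le> integral A f"
  using assms integral_nonneg[of f A] not_integrable_integral[of f A] by fastforce

text \<open>The integrand has antiderivative \<open>2 * arctan (x / (2 * sqrt s))\<close>, whose
  increment over any interval is at most \<open>2 * pi\<close>. Together with
  \<open>root_kernel_cube_le\<close> this bounds the mass of the heat kernel uniformly in
  \<open>s\<close> and \<open>X\<close>.\<close>

lemma integral_arctan_kernel:
  assumes "0 < s" "0 \<le> X"
  shows "integral (cbox (-X) X) (\<lambda>x. 1 / (sqrt s * (1 + (x / (2 * sqrt s))\<^sup>2))) \<le> 2 * pi"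
proof -
  have d: "((\<lambda>x. 2 * arctan (x / (2 * sqrt s))) has_real_derivative
      1 / (sqrt s * (1 + (x / (2 * sqrt s))\<^sup>2))) (at x)" for x
  proof -
    have "((\<lambda>x. arctan (x / (2 * sqrt s))) has_real_derivative
        inverse (1 + (x / (2 * sqrt s))\<^sup>2) * (1 / (2 * sqrt s))) (at x)"
      by (rule DERIV_chain2[OF DERIV_arctan DERIV_cdivide[OF DERIV_ident]])
    from DERIV_cmult[OF this, of 2] show ?thesis
      by (rule DERIV_cong) (simp add: inverse_eq_divide)
  qed
  have "((\<lambda>x. 1 / (sqrt s * (1 + (x / (2 * sqrt s))\<^sup>2))) has_integral
      (2 * arctan (X / (2 * sqrt s)) - 2 * arctan (-X / (2 * sqrt s)))) {-X..X}"
    by (rule fundamental_theorem_of_calculus)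
      (use assms d in \<open>auto simp flip: has_real_derivative_iff_has_vector_derivative
        intro: has_field_derivative_at_within\<close>)
  then have "integral (cbox (-X) X) (\<lambda>x. 1 / (sqrt s * (1 + (x / (2 * sqrt s))\<^sup>2)))
      = 2 * arctan (X / (2 * sqrt s)) - 2 * arctan (-X / (2 * sqrt s))"
    by (simp add: integral_unique)
  also have "\<dots> \<le> 2 * pi"
    using arctan_ubound[of "X / (2 * sqrt s)"] arctan_lbound[of "-X / (2 * sqrt s)"] by simp
  finally show ?thesis .
qed

lemma x_cutoff_le_root_kernel:
  assumes "0 \<le> \<epsilon>"
  shows "x_cutoff S \<epsilon> t x \<le> root_kernel (S - t) x"
  using assms root_kernel_pos[of "S - t" x] by (simp add: x_cutoff_def)

lemma x_cutoff_nonneg: "0 \<le> x_cutoff S \<epsilon> t x"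
  by (simp add: x_cutoff_def)

lemma yz_cutoff_nonneg: "0 \<le> yz_cutoff a k t y z"
  by (simp add: yz_cutoff_def)

lemma yz_cutoff_le:
  "yz_cutoff a k t y z \<le> (a + k * t)\<^sup>2"
  by (simp add: yz_cutoff_def)

text \<open>With \<open>k = 1\<close> the weight is a subsolution of the adjoint equation, so the weighted integral of a
  nonnegative solution increases in \<open>t\<close>; near \<open>t = b\<close> the weight lives on \<open>\<bar>x\<bar> \<le> 1\<close>.\<close>
lemma positive_solution_weighted_bound:
  assumes u: "classical_jet {0<..<b} u ut ux uxx uy uz"
    and eq: "\<And>x y z t. 0 < t \<Longrightarrow> t < b \<Longrightarrow>
      ut (x,y,z,t) - uxx (x,y,z,t) - cos x * uy (x,y,z,t) - sin x * uz (x,y,z,t) = 0"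
    and pos: "\<And>x y z t. 0 < t \<Longrightarrow> t < b \<Longrightarrow> 0 \<le> u (x,y,z,t)"
    and cont: "continuous_on (slab {0..b}) u" and b: "0 < b" and a: "0 \<le> a"
  shows "\<exists>C. \<forall>\<epsilon> X t. 0 < \<epsilon> \<longrightarrow> 0 \<le> X \<longrightarrow> 4 * sqrt b \<le> \<epsilon> ^ 3 * X\<^sup>2 \<longrightarrow> 0 < t \<longrightarrow> t < b \<longrightarrow>
    integral (cbox (-X,-(a+b),-(a+b)) (X,a+b,a+b)) (\<lambda>(x,y,z). weight b \<epsilon> a 1 (x,y,z,t) * u (x,y,z,t)) \<le> C"
proof -
  define Y where "Y = a + b"
  have Y: "0 < Y" using a b by (simp add: Y_def)
  \<comment> \<open>\<open>K\<close> contains the part of the weight's support that matters shortly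
    before time \<open>b\<close>. It is compact and reaches \<open>t = b\<close>, where
    \<open>u\<close> is still continuous, so \<open>M\<close> bounds \<open>u\<close> on it
    independently of \<epsilon>.\<close>
  define K where "K = cbox (-1,-Y,-Y,b/2) (1::real,Y,Y,b)"
  have "K \<subseteq> slab {0..b}" using b by (auto simp: K_def slab_def)
  then have "compact (u ` K)"
    by (intro compact_continuous_image continuous_on_subset[OF cont]) (auto simp: K_def)
  then have "bdd_above (u ` K)"
    by (intro bounded_imp_bdd_above compact_imp_bounded)
  then obtain M0 where M0: "\<And>p. p \<in> K \<Longrightarrow> u p \<le> M0"
    by (auto simp: bdd_above_def)
  define M where "M = max 0 M0"
  have M: "0 \<le> M" "\<And>p. p \<in> K \<Longrightarrow> u p \<le> M" using M0 unfolding M_def by (auto simp: le_max_iff_disj)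
  define V where "V = measure lborel (cbox (-Y,-Y) (Y,Y))"
  define C where "C = M * Y ^ 4 * V * (2 * pi)"
  have "integral (cbox (-X,-Y,-Y) (X,Y,Y)) (\<lambda>(x,y,z). weight b \<epsilon> a 1 (x,y,z,t) * u (x,y,z,t)) \<le> C"
    if \<epsilon>: "0 < \<epsilon>" and X: "0 \<le> X" "4 * sqrt b \<le> \<epsilon> ^ 3 * X\<^sup>2" and t: "0 < t" "t < b" for \<epsilon> X t
  proof -
    let ?B = "cbox (-X,-Y,-Y) (X,Y,Y)"
    define E where "E t = integral ?B (\<lambda>(x,y,z). weight b \<epsilon> a 1 (x,y,z,t) * u (x,y,z,t))" for t
    \<comment> \<open>The comparison time \<open>t' = b - s\<close> must lie after \<open>t\<close>,
      in the upper half of the time interval, and so close to \<open>b\<close> that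
      \<open>4 * sqrt s \<le> \<epsilon> ^ 3\<close>. By \<open>x_cutoff_eq_0\<close> the last
      condition confines the weight at time \<open>t'\<close> to
      \<open>\<bar>x\<bar> \<le> 1\<close>.\<close>
    define s where "s = min ((b - max t (b/2)) / 2) ((\<epsilon> ^ 3 / 4)\<^sup>2)"
    define t' where "t' = b - s"
    have s0: "0 < s" using t b \<epsilon> by (auto simp: s_def)
    have s1: "s \<le> (b - max t (b/2)) / 2" "s \<le> (\<epsilon> ^ 3 / 4)\<^sup>2"
      unfolding s_def by (rule min.cobounded1, rule min.cobounded2)
    have t': "t \<le> t'" "b / 2 \<le> t'" "t' < b" "b - t' = s" using s0 s1(1) t by (auto simp: t'_def)
    have ss: "4 * sqrt s \<le> \<epsilon> ^ 3"
      using real_le_lsqrt[of "\<epsilon>^3/4" s] real_sqrt_le_iff[THEN iffD2, OF s1(2)] \<epsilon> by simp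
    have "E t \<le> E t'"
    proof (rule DERIV_nonneg_imp_nondecreasing[OF t'(1)])
      fix r assume "t \<le> r" "r \<le> t'"
      then have r: "0 < r" "r < b" using t t' by auto
      have Xr: "4 * sqrt (b - r) \<le> \<epsilon> ^ 3 * X\<^sup>2" using X(2) r by (smt (verit) real_sqrt_le_iff)
      have "0 \<le> (\<epsilon> * x\<^sup>2 / (6 * (b - r)\<^sup>2) * x_cutoff b \<epsilon> r x * root_kernel (b - r) x * (yz_cutoff a 1 r y z)\<^sup>2
          + 4 * x_cutoff b \<epsilon> r x ^ 3 * yz_cutoff a 1 r y z * (1 * (a + 1 * r) + y * cos x + z * sin x)) * u (x,y,z,r)
         + weight b \<epsilon> a 1 (x,y,z,r) *
           (ut (x,y,z,r) - uxx (x,y,z,r) - cos x * uy (x,y,z,r) - sin x * uz (x,y,z,r))" for x y z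
      proof -
        have "0 \<le> yz_cutoff a 1 r y z * (1 * (a + 1 * r) + y * cos x + z * sin x)"
        proof (cases "yz_cutoff a 1 r y z = 0")
          case False
          then have "\<bar>y * cos x + z * sin x\<bar> \<le> a + 1 * r"
            using drift_bound[OF False] a r by simp
          then show ?thesis by (intro mult_nonneg_nonneg yz_cutoff_nonneg) auto
        qed simp
        then have "0 \<le> 4 * x_cutoff b \<epsilon> r x ^ 3 *
            (yz_cutoff a 1 r y z * (1 * (a + 1 * r) + y * cos x + z * sin x))"
          by (rule mult_nonneg_nonneg[rotated]) (simp add: x_cutoff_nonneg)
        moreover have "0 \<le> \<epsilon> * x\<^sup>2 / (6 * (b - r)\<^sup>2) * x_cutoff b \<epsilon> r x * root_kernel (b - r) x * (yz_cutoff a 1 r y z)\<^sup>2"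
          using \<epsilon> root_kernel_pos[of "b - r" x] by (intro mult_nonneg_nonneg divide_nonneg_nonneg) (auto simp: x_cutoff_nonneg)
        ultimately show ?thesis using eq[OF r, of x y z] pos[OF r, of x y z] by (simp add: mult.assoc)
      qed
      then have "0 \<le> integral ?B (\<lambda>(x,y,z). (\<epsilon> * x\<^sup>2 / (6 * (b - r)\<^sup>2) * x_cutoff b \<epsilon> r x * root_kernel (b - r) x * (yz_cutoff a 1 r y z)\<^sup>2
          + 4 * x_cutoff b \<epsilon> r x ^ 3 * yz_cutoff a 1 r y z * (1 * (a + 1 * r) + y * cos x + z * sin x)) * u (x,y,z,r)
         + weight b \<epsilon> a 1 (x,y,z,r) *
           (ut (x,y,z,r) - uxx (x,y,z,r) - cos x * uy (x,y,z,r) - sin x * uz (x,y,z,r)))"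
        by (intro integral_nonneg_pointwise) (auto simp del: mem_box_real)
      moreover have "(E has_real_derivative integral ?B (\<lambda>(x,y,z). (\<epsilon> * x\<^sup>2 / (6 * (b - r)\<^sup>2) * x_cutoff b \<epsilon> r x * root_kernel (b - r) x * (yz_cutoff a 1 r y z)\<^sup>2
          + 4 * x_cutoff b \<epsilon> r x ^ 3 * yz_cutoff a 1 r y z * (1 * (a + 1 * r) + y * cos x + z * sin x)) * u (x,y,z,r)
         + weight b \<epsilon> a 1 (x,y,z,r) *
           (ut (x,y,z,r) - uxx (x,y,z,r) - cos x * uy (x,y,z,r) - sin x * uz (x,y,z,r)))) (at r)"
        unfolding E_def
        by (rule cutoff_integral_has_derivative[OF u]) (use r a \<epsilon> X Xr in \<open>auto simp: Y_def\<close>)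
      ultimately show "\<exists>d. (E has_real_derivative d) (at r) \<and> 0 \<le> d" by blast
    qed
    also have "E t' \<le> C"
    proof -
      \<comment> \<open>\<open>k\<close> dominates the cubed cutoff and has mass at most
        \<open>2 * pi\<close> for every \<open>s\<close>. Hence \<open>C\<close> does not depend on
        \<epsilon>, \<open>X\<close> or \<open>t\<close>, although \<open>s\<close> was chosen from
        \<epsilon> and \<open>t\<close>.\<close>
      define k where "k x = 1 / (sqrt s * (1 + (x / (2 * sqrt s))\<^sup>2))" for x
      have ne: "sqrt s * (1 + (x / (2 * sqrt s))\<^sup>2) \<noteq> 0" for x
        using s0 by (simp add: add_nonneg_eq_0_iff)
      have k0: "0 \<le> k x" for x using s0 by (simp add: k_def)
      have ck: "continuous_on A k" for A
        unfolding k_def by (intro continuous_intros) (use ne s0 in auto)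
      have cw: "continuous_on ?B (\<lambda>p. weight b \<epsilon> a 1 (fst p, fst (snd p), snd (snd p), t'))"
        by (rule continuous_on_slab_slice[OF classical_jet_continuous(1)[OF weight_jet[where I="{..<b}"]]])
          (use t' in auto)
      have cu: "continuous_on ?B (\<lambda>p. u (fst p, fst (snd p), snd (snd p), t'))"
        by (rule continuous_on_slab_slice[OF classical_jet_continuous(1)[OF u]]) (use t t' in auto)
      have "E t' \<le> integral ?B (\<lambda>p. M * Y ^ 4 * k (fst p))"
        unfolding E_def case_prod_unfold
      proof (rule integral_le)
        show "(\<lambda>p. weight b \<epsilon> a 1 (fst p, fst (snd p), snd (snd p), t') * u (fst p, fst (snd p), snd (snd p), t')) integrable_on ?B"
          by (intro integrable_continuous continuous_on_mult cw cu)
        show "(\<lambda>p. M * Y ^ 4 * k (fst p)) integrable_on ?B"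
          by (intro integrable_continuous continuous_intros continuous_on_compose2[OF ck]) auto
        fix p assume "p \<in> ?B"
        then obtain x y z where p: "p = (x,y,z)" and yz: "\<bar>y\<bar> \<le> Y" "\<bar>z\<bar> \<le> Y" by (cases p) auto
        have "weight b \<epsilon> a 1 (x,y,z,t') * u (x,y,z,t') \<le> M * Y ^ 4 * k x"
        proof (cases "\<bar>x\<bar> \<le> 1")
          case True
          have "(x,y,z,t') \<in> K" using True yz t' by (auto simp: K_def)
          then have uM: "u (x,y,z,t') \<le> M" by (rule M)
          have "(yz_cutoff a 1 t' y z)\<^sup>2 \<le> ((a + 1 * t')\<^sup>2)\<^sup>2"
            by (intro power_mono yz_cutoff_le yz_cutoff_nonneg)
          also have "\<dots> \<le> (Y\<^sup>2)\<^sup>2" using a t t' by (intro power_mono) (auto simp: Y_def)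
          finally have 1: "(yz_cutoff a 1 t' y z)\<^sup>2 \<le> Y ^ 4" by simp
          have "x_cutoff b \<epsilon> t' x ^ 3 \<le> root_kernel s x ^ 3"
            using x_cutoff_le_root_kernel[of \<epsilon> b t' x] \<epsilon> t' by (intro power_mono x_cutoff_nonneg) auto
          also have "\<dots> \<le> k x" using root_kernel_cube_le[OF s0] by (simp add: k_def)
          finally have "x_cutoff b \<epsilon> t' x ^ 3 \<le> k x" .
          then have "weight b \<epsilon> a 1 (x,y,z,t') \<le> k x * Y ^ 4"
            unfolding weight_def case_prod_conv using 1 k0
            by (intro mult_mono) auto
          then have "weight b \<epsilon> a 1 (x,y,z,t') * u (x,y,z,t') \<le> (k x * Y ^ 4) * M"
            using uM pos[of t' x y z] t t' k0 Y by (intro mult_mono) auto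
          then show ?thesis by (simp add: mult_ac)
        next
          case False
          then have "1 \<le> x\<^sup>2" by (simp add: abs_square_le_1 not_le) (metis abs_square_le_1 linorder_le_cases not_le)
          then have "\<epsilon> ^ 3 * 1 \<le> \<epsilon> ^ 3 * x\<^sup>2" using \<epsilon> by (intro mult_left_mono) auto
          then have "4 * sqrt (b - t') \<le> \<epsilon> ^ 3 * x\<^sup>2" using ss t'(4) by simp
          then have "x_cutoff b \<epsilon> t' x = 0" by (rule x_cutoff_eq_0[OF t'(3) \<epsilon>])
          then show ?thesis using M k0 Y by (simp add: weight_def)
        qed
        then show "weight b \<epsilon> a 1 (fst p, fst (snd p), snd (snd p), t') * u (fst p, fst (snd p), snd (snd p), t')
            \<le> M * Y ^ 4 * k (fst p)" by (simp add: p)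
      qed
      also have "\<dots> = integral (cbox (-X) X) (\<lambda>x. integral (cbox (-Y,-Y) (Y,Y)) (\<lambda>p. M * Y ^ 4 * k x))"
        by (subst integral_prod_continuous)
          (auto intro!: continuous_intros continuous_on_compose2[OF ck])
      also have "\<dots> = M * Y ^ 4 * V * integral (cbox (-X) X) k"
        by (simp add: V_def mult_ac)
      also have "\<dots> \<le> C"
        unfolding C_def k_def using M Y
        by (intro mult_left_mono integral_arctan_kernel s0 X) (auto simp: V_def)
      finally show ?thesis .
    qed
    finally show ?thesis by (simp add: E_def)
  qed
  then show ?thesis unfolding Y_def by blast
qed

subsection \<open>The difference of two solutions\<close>

lemma classical_jet_diff:
  assumes u: "classical_jet I u ut ux uxx uy uz" and v: "classical_jet I v vt vx vxx vy vz"
  shows "classical_jet I (\<lambda>p. u p - v p) (\<lambda>p. ut p - vt p) (\<lambda>p. ux p - vx p) (\<lambda>p. uxx p - vxx p)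
    (\<lambda>p. uy p - vy p) (\<lambda>p. uz p - vz p)"
  unfolding classical_jet_def
  by (intro conjI allI impI continuous_on_diff classical_jet_continuous[OF u] classical_jet_continuous[OF v]
      DERIV_diff classical_jetD[OF u] classical_jetD[OF v])

text \<open>A smooth convex substitute for the absolute value: it lies below
  \<open>\<bar>r\<bar>\<close> and vanishes only at 0, so it is controlled by \<open>u + v\<close>
  and still detects \<open>u \<noteq> v\<close>.\<close>

definition soft_abs :: "real \<Rightarrow> real" where
  "soft_abs r = sqrt (1 + r\<^sup>2) - 1"

lemma one_plus_square_pos: "0 < 1 + (r::real)\<^sup>2"
  by (simp add: add_pos_nonneg)

lemma soft_abs_nonneg: "0 \<le> soft_abs r"
  by (simp add: soft_abs_def)

lemma soft_abs_le_abs: "soft_abs r \<le> \<bar>r\<bar>"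
proof -
  have "1 + r\<^sup>2 \<le> (1 + \<bar>r\<bar>)\<^sup>2" by (simp add: power2_sum)
  then have "sqrt (1 + r\<^sup>2) \<le> 1 + \<bar>r\<bar>" by (simp add: real_le_lsqrt)
  then show ?thesis by (simp add: soft_abs_def)
qed

lemma soft_abs_eq_0_iff: "soft_abs r = 0 \<longleftrightarrow> r = 0"
  by (simp add: soft_abs_def)

lemma continuous_on_soft_abs [continuous_intros]:
  "continuous_on A f \<Longrightarrow> continuous_on A (\<lambda>x. soft_abs (f x))"
  unfolding soft_abs_def by (intro continuous_intros)

lemma DERIV_sqrt_one_plus_square:
  assumes "(f has_real_derivative D) (at x)"
  shows "((\<lambda>x. sqrt (1 + (f x)\<^sup>2)) has_real_derivative f x / sqrt (1 + (f x)\<^sup>2) * D) (at x)"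
proof -
  have "((\<lambda>x. 1 + f x * f x) has_real_derivative 2 * f x * D) (at x)"
    by (rule DERIV_cong[OF DERIV_add[OF DERIV_const DERIV_mult[OF assms assms]]]) simp
  then have *: "((\<lambda>x. 1 + (f x)\<^sup>2) has_real_derivative 2 * f x * D) (at x)" by (simp add: power2_eq_square)
  show ?thesis
    by (rule DERIV_cong[OF DERIV_chain2[OF DERIV_real_sqrt *]])
      (use one_plus_square_pos[of "f x"] in \<open>auto simp: divide_simps\<close>)
qed

lemma DERIV_soft_abs_chain:
  assumes "(f has_real_derivative D) (at x)"
  shows "((\<lambda>x. soft_abs (f x)) has_real_derivative f x / sqrt (1 + (f x)\<^sup>2) * D) (at x)"
  unfolding soft_abs_def
  by (rule DERIV_cong[OF DERIV_diff[OF DERIV_sqrt_one_plus_square[OF assms] DERIV_const]]) simp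

lemma DERIV_soft_abs_slope_chain:
  assumes "(f has_real_derivative D) (at x)"
  shows "((\<lambda>x. f x / sqrt (1 + (f x)\<^sup>2)) has_real_derivative 1 / (sqrt (1 + (f x)\<^sup>2)) ^ 3 * D) (at x)"
proof -
  define R where "R = sqrt (1 + (f x)\<^sup>2)"
  have R: "R > 0" "R * R = 1 + (f x)\<^sup>2" using one_plus_square_pos[of "f x"] by (auto simp: R_def)
  have "(D * R - f x * (f x / R * D)) / (R * R) = D * (R * R - (f x)\<^sup>2) / (R * R * R)"
    using R(1) by (simp add: field_simps power2_eq_square)
  also have "\<dots> = 1 / R ^ 3 * D" using R by (simp add: power3_eq_cube)
  finally have "(D * R - f x * (f x / R * D)) / (R * R) = 1 / R ^ 3 * D" .
  then show ?thesis
    using DERIV_divide[OF assms DERIV_sqrt_one_plus_square[OF assms]] R(1)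
    unfolding R_def[symmetric] by auto
qed

lemma classical_jet_soft_abs:
  assumes f: "classical_jet I f ft fx fxx fy fz"
  shows "classical_jet I (\<lambda>p. soft_abs (f p)) (\<lambda>p. f p / sqrt (1 + (f p)\<^sup>2) * ft p)
    (\<lambda>p. f p / sqrt (1 + (f p)\<^sup>2) * fx p)
    (\<lambda>p. 1 / (sqrt (1 + (f p)\<^sup>2)) ^ 3 * (fx p)\<^sup>2 + f p / sqrt (1 + (f p)\<^sup>2) * fxx p)
    (\<lambda>p. f p / sqrt (1 + (f p)\<^sup>2) * fy p) (\<lambda>p. f p / sqrt (1 + (f p)\<^sup>2) * fz p)"
proof -
  have nz: "sqrt (1 + r\<^sup>2) \<noteq> 0" for r :: real using one_plus_square_pos[of r] by simp
  have "((\<lambda>s. f (s, y, z, t) / sqrt (1 + (f (s, y, z, t))\<^sup>2) * fx (s, y, z, t)) has_real_derivative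
      1 / (sqrt (1 + (f (x, y, z, t))\<^sup>2)) ^ 3 * (fx (x, y, z, t))\<^sup>2
      + f (x, y, z, t) / sqrt (1 + (f (x, y, z, t))\<^sup>2) * fxx (x, y, z, t)) (at x)"
    if "t \<in> I" for x y z t
    by (rule DERIV_cong[OF DERIV_mult[OF DERIV_soft_abs_slope_chain[OF classical_jetD(2)[OF f that]]
            classical_jetD(3)[OF f that]]]) (simp add: power2_eq_square)
  then show ?thesis
    unfolding classical_jet_def
    by (intro conjI allI impI continuous_intros classical_jet_continuous[OF f] DERIV_soft_abs_chain
        classical_jetD[OF f]) (use nz in auto)
qed

text \<open>Since \<open>s \<le> \<sigma>\<close> and \<open>2 * \<sigma> \<le> r\<close>, the
  squared kernel on the left decays at least like \<open>exp (- x\<^sup>2 / (6 * \<sigma>))\<close>,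
  while the cubed kernel at \<open>r\<close> decays no faster than
  \<open>exp (- x\<^sup>2 / (8 * \<sigma>))\<close>. The surplus factor
  \<open>exp (- x\<^sup>2 / (24 * \<sigma>))\<close> absorbs \<open>x\<^sup>2\<close>. The
  truncation at \<open>c * \<epsilon>\<close> is harmless because the kernel at \<open>r\<close> is
  at least \<open>2 * c * \<epsilon>\<close> wherever the kernel at \<open>s\<close> exceeds
  \<epsilon>.\<close>

lemma kernel_comparison:
  assumes \<sigma>: "0 < \<sigma>" and b: "0 < b"
  shows "\<exists>c>0. \<exists>C\<ge>0. \<forall>\<epsilon> s r x. 0 < \<epsilon> \<longrightarrow> \<sigma> / 2 \<le> s \<longrightarrow> s \<le> \<sigma> \<longrightarrow> 2 * \<sigma> \<le> r \<longrightarrow> r \<le> b \<longrightarrow>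
    \<epsilon> < root_kernel s x \<longrightarrow>
    x\<^sup>2 / (6 * s\<^sup>2) * (root_kernel s x)\<^sup>2 \<le> C * (max 0 (root_kernel r x - c * \<epsilon>)) ^ 3"
proof -
  \<comment> \<open>\<open>c\<close> is half of a lower bound for the ratio of the kernels at
    \<open>r\<close> and \<open>s\<close>. In \<open>C\<close>, 128 is the product of 16, from
    \<open>x\<^sup>2 / (6 * (\<sigma> / 2)\<^sup>2)\<close> in units of \<open>e\<close>, and 8, the
    price of halving the kernel before cubing.\<close>
  define c where "c = exp ((ln (\<sigma> / 2) - ln b) / 6) / 2"
  define C where "C = 128 / \<sigma> * exp (ln b / 2 - ln (\<sigma> / 2) / 3)"
  have "x\<^sup>2 / (6 * s\<^sup>2) * (root_kernel s x)\<^sup>2 \<le> C * (max 0 (root_kernel r x - c * \<epsilon>)) ^ 3"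
    if \<epsilon>: "0 < \<epsilon>" and s: "\<sigma> / 2 \<le> s" "s \<le> \<sigma>" and r: "2 * \<sigma> \<le> r" "r \<le> b" and g: "\<epsilon> < root_kernel s x"
    for \<epsilon> s r x
  proof -
    have pos: "0 < s" "0 < r" using \<sigma> s r by auto
    have ln_s: "ln (\<sigma> / 2) \<le> ln s" and ln_r: "ln r \<le> ln b" using \<sigma> s r pos by auto
    have xr: "x\<^sup>2 / (12 * r) \<le> x\<^sup>2 / (12 * s)" "x\<^sup>2 / (4 * r) \<le> x\<^sup>2 / (8 * \<sigma>)"
      "x\<^sup>2 / (6 * \<sigma>) \<le> x\<^sup>2 / (6 * s)"
      using \<sigma> s r by (auto intro!: divide_left_mono)
    have lin: "(p - q) / 6 + (- u / 6 - v) \<le> - w / 6 - A" if "p \<le> u" "w \<le> q" "A \<le> v"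
      for p q u v w A :: real using that by (simp add: field_simps)
    have "2 * c * \<epsilon> \<le> exp ((ln (\<sigma> / 2) - ln b) / 6) * root_kernel s x"
      using g \<epsilon> by (simp add: c_def)
    also have "\<dots> \<le> root_kernel r x"
      unfolding root_kernel_def exp_add[symmetric] exp_le_cancel_iff
      by (rule lin[OF ln_s ln_r xr(1)])
    finally have half: "root_kernel r x / 2 \<le> root_kernel r x - c * \<epsilon>" by simp
    have "(root_kernel r x) ^ 3 / 8 = (root_kernel r x / 2) ^ 3" by (simp add: power_divide)
    also have "\<dots> \<le> (max 0 (root_kernel r x - c * \<epsilon>)) ^ 3"
      using half root_kernel_pos[of r x] by (intro power_mono) auto
    finally have cube: "(root_kernel r x) ^ 3 / 8 \<le> (max 0 (root_kernel r x - c * \<epsilon>)) ^ 3" .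
    have "(root_kernel s x)\<^sup>2 = exp (- ln s / 3 - x\<^sup>2 / (6 * s))"
      unfolding root_kernel_def by (simp add: exp_of_nat_mult[symmetric] power2_eq_square exp_add[symmetric])
    also have "\<dots> \<le> exp (- ln (\<sigma> / 2) / 3 - x\<^sup>2 / (6 * \<sigma>))"
      using ln_s xr(3) by simp
    finally have g2: "(root_kernel s x)\<^sup>2 \<le> exp (- ln (\<sigma> / 2) / 3 - x\<^sup>2 / (6 * \<sigma>))" .
    have "exp (- ln b / 2 - x\<^sup>2 / (8 * \<sigma>)) \<le> exp (- ln r / 2 - x\<^sup>2 / (4 * r))"
      using ln_r xr(2) by simp
    also have "\<dots> = (root_kernel r x) ^ 3"
      unfolding root_kernel_def by (simp add: exp_of_nat_mult[symmetric] field_simps)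
    finally have g3: "exp (- ln b / 2 - x\<^sup>2 / (8 * \<sigma>)) \<le> (root_kernel r x) ^ 3" .
    define e where "e = x\<^sup>2 / (24 * \<sigma>)"
    have "e \<le> exp e" using exp_ge_add_one_self[of e] by linarith
    then have e: "e * exp (- e) \<le> 1" by (simp add: exp_minus field_simps)
    have x2: "x\<^sup>2 = 24 * \<sigma> * e" using \<sigma> by (simp add: e_def)
    have s2: "(\<sigma> / 2)\<^sup>2 \<le> s\<^sup>2" using \<sigma> s by (intro power_mono) auto
    have "x\<^sup>2 / (6 * s\<^sup>2) * (root_kernel s x)\<^sup>2 \<le>
        x\<^sup>2 / (6 * (\<sigma> / 2)\<^sup>2) * exp (- ln (\<sigma> / 2) / 3 - x\<^sup>2 / (6 * \<sigma>))"
      using g2 s2 \<sigma> pos by (intro mult_mono divide_left_mono) (auto intro!: mult_pos_pos)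
    also have "x\<^sup>2 / (6 * (\<sigma> / 2)\<^sup>2) = 16 / \<sigma> * e"
      unfolding x2 using \<sigma> by (simp add: power2_eq_square field_simps)
    also have "exp (- ln (\<sigma> / 2) / 3 - x\<^sup>2 / (6 * \<sigma>)) =
        exp (- e) * exp (ln b / 2 - ln (\<sigma> / 2) / 3) * exp (- ln b / 2 - x\<^sup>2 / (8 * \<sigma>))"
      unfolding exp_add[symmetric] using \<sigma> by (simp add: e_def field_simps)
    also have "16 / \<sigma> * e * (exp (- e) * exp (ln b / 2 - ln (\<sigma> / 2) / 3) * exp (- ln b / 2 - x\<^sup>2 / (8 * \<sigma>)))
        = (e * exp (- e)) * (16 / \<sigma> * exp (ln b / 2 - ln (\<sigma> / 2) / 3) * exp (- ln b / 2 - x\<^sup>2 / (8 * \<sigma>)))"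
      by (simp add: mult_ac)
    also have "\<dots> \<le> 1 * (16 / \<sigma> * exp (ln b / 2 - ln (\<sigma> / 2) / 3) * (root_kernel r x) ^ 3)"
      using e g3 \<sigma> by (intro mult_mono mult_left_mono) (auto simp: e_def)
    also have "\<dots> = C * ((root_kernel r x) ^ 3 / 8)"
      by (simp add: C_def)
    also have "\<dots> \<le> C * (max 0 (root_kernel r x - c * \<epsilon>)) ^ 3"
      using cube \<sigma> by (intro mult_left_mono) (auto simp: C_def)
    finally show ?thesis .
  qed
  moreover have "0 < c" "0 \<le> C" using \<sigma> by (auto simp: c_def C_def)
  ultimately show ?thesis by blast
qed

text \<open>Kato's inequality, in the smooth form given by convexity of \<open>soft_abs\<close>.\<close>
lemma soft_abs_subsolution:
  fixes d :: real
  assumes "dt - dxx - cos x * dy - sin x * dz = 0"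
  shows "d / sqrt (1 + d\<^sup>2) * dt - (1 / (sqrt (1 + d\<^sup>2)) ^ 3 * dx\<^sup>2 + d / sqrt (1 + d\<^sup>2) * dxx)
    - cos x * (d / sqrt (1 + d\<^sup>2) * dy) - sin x * (d / sqrt (1 + d\<^sup>2) * dz) \<le> 0"
proof -
  define c where "c = d / sqrt (1 + d\<^sup>2)"
  have "c * dt - c * dxx - cos x * (c * dy) - sin x * (c * dz) = c * (dt - dxx - cos x * dy - sin x * dz)"
    by (simp add: algebra_simps)
  also have "\<dots> = 0" using assms by simp
  finally have "c * dt - c * dxx - cos x * (c * dy) - sin x * (c * dz) = 0" .
  moreover have "0 \<le> 1 / (sqrt (1 + d\<^sup>2)) ^ 3 * dx\<^sup>2" by simp
  ultimately show ?thesis unfolding c_def[symmetric] by linarith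
qed

text \<open>The narrow weight, with end time \<open>t0 + \<sigma>\<close> and shrinking disc, is
  tested against \<open>soft_abs (u - v)\<close>; the wide weight, with end time \<open>b\<close>
  and growing disc, against \<open>u\<close> and \<open>v\<close>. The truncation error of the first
  is dominated by \<epsilon> times the second, whose integrals are bounded. The step length
  \<open>\<sigma> / 2\<close> is the same for all \<open>t0\<close>, which permits
  iteration.\<close>

lemma vanishing_persists:
  assumes u: "classical_jet {0<..<b} u ut ux uxx uy uz" and v: "classical_jet {0<..<b} v vt vx vxx vy vz"
    and equ: "\<And>x y z t. 0 < t \<Longrightarrow> t < b \<Longrightarrow>
      ut (x,y,z,t) - uxx (x,y,z,t) - cos x * uy (x,y,z,t) - sin x * uz (x,y,z,t) = 0"
    and eqv: "\<And>x y z t. 0 < t \<Longrightarrow> t < b \<Longrightarrow>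
      vt (x,y,z,t) - vxx (x,y,z,t) - cos x * vy (x,y,z,t) - sin x * vz (x,y,z,t) = 0"
    and posu: "\<And>x y z t. 0 < t \<Longrightarrow> t < b \<Longrightarrow> 0 \<le> u (x,y,z,t)"
    and posv: "\<And>x y z t. 0 < t \<Longrightarrow> t < b \<Longrightarrow> 0 \<le> v (x,y,z,t)"
    and contu: "continuous_on (slab {0..b}) u" and contv: "continuous_on (slab {0..b}) v"
    and \<sigma>: "0 < \<sigma>" and t0: "0 \<le> t0" "t0 + 4 * \<sigma> \<le> b"
    and init: "\<And>x y z. u (x,y,z,t0) = v (x,y,z,t0)"
    and t1: "t0 < t1" "t1 \<le> t0 + \<sigma> / 2"
  shows "u (x1,y1,z1,t1) = v (x1,y1,z1,t1)"
proof -
  have b: "0 < b" using \<sigma> t0 by linarith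
  \<comment> \<open>At time \<open>t1 \<le> b\<close> the shrinking disc still has radius at least
    \<open>1 + sqrt (y1\<^sup>2 + z1\<^sup>2)\<close>, so it contains the target point. The extra 1
    in \<open>aA\<close> makes the wide disc cutoff at least 1 on the narrow disc, and
    \<open>Y\<close> is large enough for both discs.\<close>
  define aB where "aB = b + 1 + sqrt (y1\<^sup>2 + z1\<^sup>2)"
  define aA where "aA = aB + 1"
  define Y where "Y = aA + b"
  define S where "S = t0 + \<sigma>"
  have aB: "0 \<le> aB" "b \<le> aB" and aA: "0 \<le> aA" using b by (auto simp: aB_def aA_def)
  define d where "d p = u p - v p" for p
  define w where "w p = soft_abs (d p)" for p
  note dj = classical_jet_diff[OF u v, folded d_def]
  define wt where "wt p = d p / sqrt (1 + (d p)\<^sup>2) * (ut p - vt p)" for p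
  define wx where "wx p = d p / sqrt (1 + (d p)\<^sup>2) * (ux p - vx p)" for p
  define wxx where "wxx p = 1 / (sqrt (1 + (d p)\<^sup>2)) ^ 3 * (ux p - vx p)\<^sup>2
      + d p / sqrt (1 + (d p)\<^sup>2) * (uxx p - vxx p)" for p
  define wy where "wy p = d p / sqrt (1 + (d p)\<^sup>2) * (uy p - vy p)" for p
  define wz where "wz p = d p / sqrt (1 + (d p)\<^sup>2) * (uz p - vz p)" for p
  have wj: "classical_jet {0<..<b} w wt wx wxx wy wz"
    unfolding w_def[abs_def] wt_def[abs_def] wx_def[abs_def] wxx_def[abs_def] wy_def[abs_def] wz_def[abs_def]
    by (rule classical_jet_soft_abs[OF dj])
  obtain c C where c: "0 < c" and C: "0 \<le> C" and cmp: "\<And>\<epsilon> s r x. 0 < \<epsilon> \<Longrightarrow> \<sigma> / 2 \<le> s \<Longrightarrow> s \<le> \<sigma> \<Longrightarrow>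
      2 * \<sigma> \<le> r \<Longrightarrow> r \<le> b \<Longrightarrow> \<epsilon> < root_kernel s x \<Longrightarrow>
      x\<^sup>2 / (6 * s\<^sup>2) * (root_kernel s x)\<^sup>2 \<le> C * (max 0 (root_kernel r x - c * \<epsilon>)) ^ 3"
    using kernel_comparison[OF \<sigma> b] by auto
  obtain Cu where Cu: "\<And>\<epsilon> X t. 0 < \<epsilon> \<Longrightarrow> 0 \<le> X \<Longrightarrow> 4 * sqrt b \<le> \<epsilon> ^ 3 * X\<^sup>2 \<Longrightarrow> 0 < t \<Longrightarrow> t < b \<Longrightarrow>
    integral (cbox (-X,-Y,-Y) (X,Y,Y)) (\<lambda>(x,y,z). weight b \<epsilon> aA 1 (x,y,z,t) * u (x,y,z,t)) \<le> Cu"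
    using positive_solution_weighted_bound[OF u equ posu contu b aA] unfolding Y_def by blast
  obtain Cv where Cv: "\<And>\<epsilon> X t. 0 < \<epsilon> \<Longrightarrow> 0 \<le> X \<Longrightarrow> 4 * sqrt b \<le> \<epsilon> ^ 3 * X\<^sup>2 \<Longrightarrow> 0 < t \<Longrightarrow> t < b \<Longrightarrow>
    integral (cbox (-X,-Y,-Y) (X,Y,Y)) (\<lambda>(x,y,z). weight b \<epsilon> aA 1 (x,y,z,t) * v (x,y,z,t)) \<le> Cv"
    using positive_solution_weighted_bound[OF v eqv posv contv b aA] unfolding Y_def by blast
  define C' where "C' = aB ^ 4 * C * (Cu + Cv)"
  \<comment> \<open>The two lower bounds on \<open>X\<close> make the box contain the supports of
    the kernel truncated at \<epsilon> and of the wider kernel truncated at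
    \<open>c * \<epsilon>\<close>.\<close>
  have growth: "integral (cbox (-X,-Y,-Y) (X,Y,Y)) (\<lambda>(x,y,z). weight S \<epsilon> aB (-1) (x,y,z,t1) * w (x,y,z,t1))
      \<le> \<epsilon> * (C' * (t1 - t0))"
    if \<epsilon>: "0 < \<epsilon>" and X: "0 \<le> X" "4 * sqrt \<sigma> \<le> \<epsilon> ^ 3 * X\<^sup>2" "4 * sqrt b \<le> (c * \<epsilon>) ^ 3 * X\<^sup>2" for \<epsilon> X
  proof -
    let ?B = "cbox (-X,-Y,-Y) (X,Y,Y)"
    define E where "E t = integral ?B (\<lambda>(x,y,z). weight S \<epsilon> aB (-1) (x,y,z,t) * w (x,y,z,t))" for t
    have sub: "slab {t0..t1} \<subseteq> slab {0..b}" using t0 t1 \<sigma> by (auto simp: slab_def)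
    have cw: "continuous_on (slab {t0..t1}) (\<lambda>p. weight S \<epsilon> aB (-1) p * w p)"
      unfolding w_def d_def
      by (intro continuous_intros classical_jet_continuous(1)[OF weight_jet]
          continuous_on_subset[OF contu sub] continuous_on_subset[OF contv sub])
        (use t1 \<sigma> in \<open>auto simp: S_def\<close>)
    have contE: "continuous_on {t0..t1} E"
      unfolding E_def
      using integral_continuous_on_param[OF continuous_on_slab_swap[OF cw, of ?B]]
      by (simp add: case_prod_unfold)
    have "\<exists>D. (E has_real_derivative D) (at t) \<and> D \<le> \<epsilon> * C'" if t: "t0 < t" "t < t1" for t
    proof -
      have tb: "0 < t" "t < b" using t t0 t1 \<sigma> by auto
      have s: "\<sigma> / 2 \<le> S - t" "S - t \<le> \<sigma>" using t t1 by (auto simp: S_def)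
      have r: "2 * \<sigma> \<le> b - t" "b - t \<le> b" using t t1 t0 \<sigma> by auto
      \<comment> \<open>On \<open>J\<close> the jet of \<open>w\<close> is available and the narrow
        kernel is not yet singular.\<close>
      define J where "J = {0<..<min b S}"
      have J: "open J" "convex J" "J \<subseteq> {..<S}" "t \<in> J" "J \<subseteq> {0<..<b}"
        using t tb s \<sigma> by (auto simp: J_def)
      have wjJ: "classical_jet J w wt wx wxx wy wz"
        by (rule classical_jet_mono[OF wj J(5)])
      have Xt: "4 * sqrt (S - t) \<le> \<epsilon> ^ 3 * X\<^sup>2"
        using X(2) s(2) real_sqrt_le_iff[of "S - t" \<sigma>] by linarith
      have kt: "0 \<le> aB + (-1) * t" "aB + (-1) * t \<le> Y" using aB tb aA by (auto simp: Y_def aA_def)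
      note der = cutoff_integral_has_derivative[OF wjJ J(1-4) \<epsilon> X(1) Xt kt, folded E_def]
      let ?F = "\<lambda>(x,y,z). (\<epsilon> * x\<^sup>2 / (6 * (S - t)\<^sup>2) * x_cutoff S \<epsilon> t x * root_kernel (S - t) x * (yz_cutoff aB (-1) t y z)\<^sup>2
          + 4 * x_cutoff S \<epsilon> t x ^ 3 * yz_cutoff aB (-1) t y z * ((-1) * (aB + (-1) * t) + y * cos x + z * sin x)) * w (x,y,z,t)
         + weight S \<epsilon> aB (-1) (x,y,z,t) *
           (wt (x,y,z,t) - wxx (x,y,z,t) - cos x * wy (x,y,z,t) - sin x * wz (x,y,z,t))"
      let ?W = "\<lambda>f p. case p of (x,y,z) \<Rightarrow> weight b (c * \<epsilon>) aA 1 (x,y,z,t) * f (x,y,z,t)"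
      have intW: "?W f integrable_on ?B" if "classical_jet {0<..<b} f ft fx fxx fy fz" for f ft fx fxx fy fz
        unfolding case_prod_unfold
        by (intro integrable_continuous continuous_on_mult
            continuous_on_slab_slice[OF classical_jet_continuous(1)[OF that]]
            continuous_on_slab_slice[OF classical_jet_continuous(1)[OF weight_jet[where I="{..<b}"]]])
          (use tb in auto)
      have cF: "continuous_on ?B ?F"
      proof -
        have sl: "continuous_on ?B (\<lambda>p. q (fst p, fst (snd p), snd (snd p), t))"
          if "continuous_on (slab J) q" for q :: "real \<times> real \<times> real \<times> real \<Rightarrow> real"
          by (rule continuous_on_slab_slice[OF that J(4)])
        have nz: "S - t \<noteq> 0" using s \<sigma> by auto
        note cs = sl[OF classical_jet_continuous(1)[OF wjJ]] sl[OF classical_jet_continuous(2)[OF wjJ]]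
          sl[OF classical_jet_continuous(4)[OF wjJ]] sl[OF classical_jet_continuous(5)[OF wjJ]]
          sl[OF classical_jet_continuous(6)[OF wjJ]]
          sl[OF classical_jet_continuous(1)[OF weight_jet[OF J(3), of \<epsilon> aB "-1"]]]
        have rk: "continuous_on ?B (\<lambda>p. root_kernel (S - t) (fst p))"
          unfolding root_kernel_def by (intro continuous_intros) (use nz in auto)
        have xc: "continuous_on ?B (\<lambda>p. x_cutoff S \<epsilon> t (fst p))"
          unfolding x_cutoff_def by (intro continuous_intros rk)
        have yc: "continuous_on ?B (\<lambda>p. yz_cutoff aB (-1) t (fst (snd p)) (snd (snd p)))"
          unfolding yz_cutoff_def by (intro continuous_intros)
        show ?thesis
          unfolding case_prod_unfold by (intro continuous_intros cs rk xc yc) (use nz in auto)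
      qed
      \<comment> \<open>The drift term and the convexity term are nonpositive and are dropped. What
        remains is the truncation error times \<open>w\<close>, estimated by
        \<open>kernel_comparison\<close> and \<open>w \<le> u + v\<close>.\<close>
      have pw: "?F p \<le> \<epsilon> * (aB ^ 4 * C) * (?W u p + ?W v p)" if "p \<in> ?B" for p
      proof -
        obtain x y z where p: "p = (x,y,z)" by (cases p)
        have W0: "0 \<le> weight b (c * \<epsilon>) aA 1 (x,y,z,t)" by (rule weight_nonneg)
        have uv0: "0 \<le> u (x,y,z,t)" "0 \<le> v (x,y,z,t)" using posu posv tb by auto
        have w0: "0 \<le> w (x,y,z,t)" by (simp add: w_def soft_abs_nonneg)
        have wuv: "w (x,y,z,t) \<le> u (x,y,z,t) + v (x,y,z,t)"
          using soft_abs_le_abs[of "d (x,y,z,t)"] uv0 by (simp add: w_def d_def)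
        have K: "weight S \<epsilon> aB (-1) (x,y,z,t) *
           (wt (x,y,z,t) - wxx (x,y,z,t) - cos x * wy (x,y,z,t) - sin x * wz (x,y,z,t)) \<le> 0"
          using equ[OF tb, of x y z] eqv[OF tb, of x y z]
          unfolding wt_def wxx_def wy_def wz_def
          by (intro mult_nonneg_nonpos weight_nonneg soft_abs_subsolution) (simp add: algebra_simps)
        have D: "4 * x_cutoff S \<epsilon> t x ^ 3 * yz_cutoff aB (-1) t y z * ((-1) * (aB + (-1) * t) + y * cos x + z * sin x) \<le> 0"
        proof (cases "yz_cutoff aB (-1) t y z = 0")
          case False
          then have "\<bar>y * cos x + z * sin x\<bar> \<le> aB + (-1) * t" by (rule drift_bound) (rule kt)
          then show ?thesis
            by (intro mult_nonneg_nonpos mult_nonneg_nonneg zero_le_power x_cutoff_nonneg yz_cutoff_nonneg) auto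
        qed simp
        define e where "e = \<epsilon> * x\<^sup>2 / (6 * (S - t)\<^sup>2) * x_cutoff S \<epsilon> t x * root_kernel (S - t) x * (yz_cutoff aB (-1) t y z)\<^sup>2"
        have e: "e \<le> \<epsilon> * (aB ^ 4 * C) * weight b (c * \<epsilon>) aA 1 (x,y,z,t)"
        proof (cases "x_cutoff S \<epsilon> t x = 0 \<or> yz_cutoff aB (-1) t y z = 0")
          case True
          have "0 \<le> \<epsilon> * (aB ^ 4 * C) * weight b (c * \<epsilon>) aA 1 (x,y,z,t)"
            using \<epsilon> aB C W0 by simp
          then show ?thesis using True by (auto simp: e_def)
        next
          case False
          then have g: "\<epsilon> < root_kernel (S - t) x" by (auto simp: x_cutoff_def max_def split: if_splits)
          have yc0: "0 < yz_cutoff aB (-1) t y z" using False yz_cutoff_nonneg[of aB "-1" t y z] by simp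
          then have "y\<^sup>2 + z\<^sup>2 \<le> (aB + (-1) * t)\<^sup>2" by (auto simp: yz_cutoff_def max_def split: if_splits)
          also have "\<dots> \<le> aB\<^sup>2" using kt tb by (intro power_mono) auto
          finally have yz: "y\<^sup>2 + z\<^sup>2 \<le> aB\<^sup>2" .
          have "1 + aB\<^sup>2 \<le> (aA + 1 * t)\<^sup>2"
          proof -
            have "1 + aB\<^sup>2 \<le> aA\<^sup>2" using aB by (simp add: aA_def power2_sum)
            also have "\<dots> \<le> (aA + 1 * t)\<^sup>2" using aA tb by (intro power_mono) auto
            finally show ?thesis .
          qed
          then have "1 \<le> yz_cutoff aA 1 t y z" using yz by (simp add: yz_cutoff_def)
          then have q: "1 \<le> (yz_cutoff aA 1 t y z)\<^sup>2" by (simp add: one_le_power)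
          have "(yz_cutoff aB (-1) t y z)\<^sup>2 \<le> ((aB + (-1) * t)\<^sup>2)\<^sup>2"
            by (intro power_mono yz_cutoff_le yz_cutoff_nonneg)
          also have "\<dots> \<le> (aB\<^sup>2)\<^sup>2" using kt tb by (intro power_mono) auto
          finally have q': "(yz_cutoff aB (-1) t y z)\<^sup>2 \<le> aB ^ 4" by simp
          have g2: "x_cutoff S \<epsilon> t x * root_kernel (S - t) x \<le> (root_kernel (S - t) x)\<^sup>2"
            unfolding power2_eq_square using \<epsilon> root_kernel_pos[of "S - t" x]
            by (intro mult_right_mono x_cutoff_le_root_kernel) auto
          have "x\<^sup>2 / (6 * (S - t)\<^sup>2) * (x_cutoff S \<epsilon> t x * root_kernel (S - t) x)
              \<le> x\<^sup>2 / (6 * (S - t)\<^sup>2) * (root_kernel (S - t) x)\<^sup>2"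
            using g2 by (intro mult_left_mono) auto
          also have "\<dots> \<le> C * x_cutoff b (c * \<epsilon>) t x ^ 3"
            unfolding x_cutoff_def by (rule cmp[OF \<epsilon> s r g])
          also have "\<dots> \<le> C * (x_cutoff b (c * \<epsilon>) t x ^ 3 * (yz_cutoff aA 1 t y z)\<^sup>2)"
            using mult_left_mono[OF q, of "x_cutoff b (c * \<epsilon>) t x ^ 3"] C x_cutoff_nonneg[of b "c * \<epsilon>" t x]
            by (intro mult_left_mono) auto
          finally have *: "x\<^sup>2 / (6 * (S - t)\<^sup>2) * (x_cutoff S \<epsilon> t x * root_kernel (S - t) x)
            \<le> C * weight b (c * \<epsilon>) aA 1 (x,y,z,t)" by (simp add: weight_def)
          have "x\<^sup>2 / (6 * (S - t)\<^sup>2) * (x_cutoff S \<epsilon> t x * root_kernel (S - t) x) * (yz_cutoff aB (-1) t y z)\<^sup>2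
             \<le> (C * weight b (c * \<epsilon>) aA 1 (x,y,z,t)) * aB ^ 4"
            by (rule mult_mono[OF * q']) (use C W0 in auto)
          from mult_left_mono[OF this, of \<epsilon>] \<epsilon> show ?thesis
            by (simp add: e_def mult_ac)
        qed
        have drop: "(e + r) * q + k \<le> e * q" if "r * q \<le> 0" "k \<le> 0" for r q k :: real
          using that by (simp add: distrib_right)
        have "?F p \<le> e * w (x,y,z,t)"
          unfolding p case_prod_conv e_def[symmetric]
          by (rule drop[OF mult_nonpos_nonneg[OF D w0] K])
        also have "\<dots> \<le> \<epsilon> * (aB ^ 4 * C) * weight b (c * \<epsilon>) aA 1 (x,y,z,t) * (u (x,y,z,t) + v (x,y,z,t))"
          by (rule mult_mono[OF e wuv]) (use w0 W0 \<epsilon> C aB in auto)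
        also have "\<dots> = \<epsilon> * (aB ^ 4 * C) * (?W u p + ?W v p)"
          unfolding p case_prod_conv by (simp add: algebra_simps)
        finally show ?thesis .
      qed
      have "integral ?B ?F \<le> integral ?B (\<lambda>p. \<epsilon> * (aB ^ 4 * C) * (?W u p + ?W v p))"
        by (intro integral_le integrable_continuous cF integrable_on_mult_right integrable_add intW[OF u] intW[OF v] pw)
      also have "\<dots> = \<epsilon> * (aB ^ 4 * C) * (integral ?B (?W u) + integral ?B (?W v))"
        by (simp add: integral_add[OF intW[OF u] intW[OF v]])
      also have "\<dots> \<le> \<epsilon> * (aB ^ 4 * C) * (Cu + Cv)"
        using \<epsilon> C aB c by (intro mult_left_mono add_mono Cu Cv X tb) auto
      also have "\<dots> = \<epsilon> * C'" by (simp add: C'_def)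
      finally show ?thesis using der by blast
    qed
    then have D: "\<And>t. t0 < t \<Longrightarrow> t < t1 \<Longrightarrow> \<exists>D. (E has_real_derivative D) (at t) \<and> D \<le> \<epsilon> * C'" by blast
    \<comment> \<open>The mean value theorem needs only continuity at the endpoints, which matters
      when \<open>t0 = 0\<close>.\<close>
    then obtain l m where m: "t0 < m" "m < t1" "DERIV E m :> l" "E t1 - E t0 = (t1 - t0) * l"
      using MVT[OF t1(1) contE] real_differentiable_def by blast
    have "l \<le> \<epsilon> * C'" using D[OF m(1,2)] m(3) DERIV_unique by blast
    then have "(t1 - t0) * l \<le> (t1 - t0) * (\<epsilon> * C')" using t1 by (intro mult_left_mono) auto
    moreover have "E t0 = 0"
      using init by (simp add: E_def w_def d_def soft_abs_def case_prod_unfold)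
    ultimately show ?thesis using m(4) by (simp add: E_def mult_ac)
  qed
  \<comment> \<open>Half the kernel value at the target, so the weight truncated at this level is
    positive there.\<close>
  define \<epsilon>0 where "\<epsilon>0 = root_kernel (S - t1) x1 / 2"
  have \<epsilon>0: "0 < \<epsilon>0" "\<epsilon>0 < root_kernel (S - t1) x1" using root_kernel_pos[of "S - t1" x1] by (auto simp: \<epsilon>0_def)
  define X0 where "X0 = \<bar>x1\<bar> + 1"
  have Y0: "0 < Y" using aA b by (simp add: Y_def)
  let ?N = "cbox (-X0,-Y,-Y) (X0,Y,Y)"
  have S1: "t1 < S" using t1 \<sigma> by (simp add: S_def)
  have cN: "continuous_on A (\<lambda>p. weight S \<epsilon> aB (-1) (fst p, fst (snd p), snd (snd p), t1) * w (fst p, fst (snd p), snd (snd p), t1))" for A \<epsilon>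
    by (intro continuous_on_mult continuous_on_slab_slice[OF classical_jet_continuous(1)[OF wj]]
         continuous_on_slab_slice[OF classical_jet_continuous(1)[OF weight_jet[where I="{..<S}"]]])
      (use S1 t0 t1 \<sigma> in auto)
  define j where "j \<epsilon> p = weight S \<epsilon> aB (-1) (fst p, fst (snd p), snd (snd p), t1) * w (fst p, fst (snd p), snd (snd p), t1)" for \<epsilon> p
  have j0: "0 \<le> j \<epsilon> p" for \<epsilon> p by (simp add: j_def w_def weight_nonneg soft_abs_nonneg)
  have ji: "j \<epsilon> integrable_on cbox p q" for \<epsilon> p q
    using integrable_continuous[OF cN] by (simp add: j_def[abs_def])
  \<comment> \<open>Lowering the truncation level increases the weight, and the integrand is
    nonnegative on the larger box. A quantity independent of \<epsilon> is thus bounded by a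
    multiple of \<epsilon>.\<close>
  have small: "integral ?N (j \<epsilon>0) \<le> \<epsilon> * (C' * (t1 - t0))" if \<epsilon>: "0 < \<epsilon>" "\<epsilon> \<le> \<epsilon>0" for \<epsilon>
  proof -
    \<comment> \<open>\<open>Q\<close> is the least value of \<open>X\<^sup>2\<close> meeting both
      size conditions of \<open>growth\<close>.\<close>
    define Q where "Q = max (4 * sqrt \<sigma> / \<epsilon> ^ 3) (4 * sqrt b / (c * \<epsilon>) ^ 3)"
    define X where "X = max X0 (sqrt Q)"
    have X: "0 \<le> X" "X0 \<le> X" "sqrt Q \<le> X" by (auto simp: X_def X0_def)
    have Q0: "0 \<le> Q" using \<sigma> \<epsilon> by (auto simp: Q_def le_max_iff_disj)
    have "Q = (sqrt Q)\<^sup>2" using Q0 by simp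
    also have "\<dots> \<le> X\<^sup>2" using X Q0 by (intro power_mono) auto
    finally have "4 * sqrt \<sigma> / \<epsilon> ^ 3 \<le> X\<^sup>2" "4 * sqrt b / (c * \<epsilon>) ^ 3 \<le> X\<^sup>2" by (auto simp: Q_def)
    then have X2: "4 * sqrt \<sigma> \<le> \<epsilon> ^ 3 * X\<^sup>2" "4 * sqrt b \<le> (c * \<epsilon>) ^ 3 * X\<^sup>2"
      using \<epsilon> c by (simp_all add: divide_le_eq mult.commute)
    have "integral ?N (j \<epsilon>0) \<le> integral (cbox (-X,-Y,-Y) (X,Y,Y)) (j \<epsilon>0)"
      using X by (intro integral_subset_le ji) (auto simp: j0)
    also have "\<dots> \<le> integral (cbox (-X,-Y,-Y) (X,Y,Y)) (j \<epsilon>)"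
    proof (intro integral_le ji)
      fix p :: "real \<times> real \<times> real"
      have "x_cutoff S \<epsilon>0 t1 x ^ 3 \<le> x_cutoff S \<epsilon> t1 x ^ 3" for x
        using \<epsilon> by (intro power_mono) (auto simp: x_cutoff_def)
      then show "j \<epsilon>0 p \<le> j \<epsilon> p"
        by (auto simp: j_def weight_def w_def soft_abs_nonneg intro!: mult_right_mono)
    qed
    also have "\<dots> \<le> \<epsilon> * (C' * (t1 - t0))"
      using growth[OF \<epsilon>(1) X(1) X2] by (simp add: j_def[abs_def] case_prod_unfold)
    finally show ?thesis .
  qed
  have "integral ?N (j \<epsilon>0) \<le> 0"
  proof (rule ccontr)
    define H where "H = integral ?N (j \<epsilon>0)"
    assume "\<not> integral ?N (j \<epsilon>0) \<le> 0"
    then have H: "0 < H" by (simp add: H_def)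
    \<comment> \<open>The summand 1 makes \<open>G\<close> positive and strictly larger than the
      growth constant, so \<open>\<epsilon> \<le> H / G\<close> yields the strict contradiction
      \<open>H < H\<close>.\<close>
    define G where "G = \<bar>C' * (t1 - t0)\<bar> + 1"
    have G: "0 < G" "C' * (t1 - t0) \<le> G - 1" by (auto simp: G_def)
    define \<epsilon> where "\<epsilon> = min \<epsilon>0 (H / G)"
    have \<epsilon>: "0 < \<epsilon>" "\<epsilon> \<le> \<epsilon>0" "\<epsilon> \<le> H / G" using \<epsilon>0 H G by (auto simp: \<epsilon>_def)
    have "H \<le> \<epsilon> * (C' * (t1 - t0))" using small[OF \<epsilon>(1,2)] by (simp add: H_def)
    also have "\<dots> \<le> \<epsilon> * (G - 1)" using G \<epsilon> by (intro mult_left_mono) auto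
    also have "\<dots> < \<epsilon> * G" using \<epsilon> by simp
    also have "\<dots> \<le> H" using \<epsilon>(3) G by (simp add: le_divide_eq)
    finally show False by simp
  qed
  then have "integral ?N (j \<epsilon>0) = 0"
    using integral_nonneg_pointwise[of ?N "j \<epsilon>0"] j0 by (meson antisym)
  moreover have "box (-X0,-Y,-Y) (X0,Y,Y) \<noteq> {}"
  proof -
    have "(0,0,0) \<in> box (-X0,-Y,-Y) (X0,Y,Y)" using Y0 by (auto simp: X0_def box_def Basis_prod_def)
    then show ?thesis by blast
  qed
  \<comment> \<open>A continuous nonnegative function with zero integral over a nondegenerate box
    vanishes at every point of it.\<close>
  ultimately have z: "\<forall>p\<in>?N. j \<epsilon>0 p = 0"
    using integral_cbox_eq_0_iff[of "(-X0,-Y,-Y)" "(X0,Y,Y)" "j \<epsilon>0"] j0 cN[of _ \<epsilon>0]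
    by (auto simp: j_def[abs_def])
  have yz1: "y1\<^sup>2 + z1\<^sup>2 < (aB + (-1) * t1)\<^sup>2"
  proof -
    have "(sqrt (y1\<^sup>2 + z1\<^sup>2))\<^sup>2 < (aB + (-1) * t1)\<^sup>2"
      using t1 t0 \<sigma> by (intro power_strict_mono) (auto simp: aB_def)
    then show ?thesis by simp
  qed
  have "\<bar>y1\<bar> \<le> sqrt (y1\<^sup>2 + z1\<^sup>2)" "\<bar>z1\<bar> \<le> sqrt (y1\<^sup>2 + z1\<^sup>2)"
    by (auto simp: real_le_rsqrt)
  then have "\<bar>y1\<bar> \<le> Y" "\<bar>z1\<bar> \<le> Y" using b unfolding Y_def aA_def aB_def by linarith+
  then have "(x1,y1,z1) \<in> ?N" by (auto simp: X0_def)
  with z have "j \<epsilon>0 (x1,y1,z1) = 0" by blast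
  moreover have "0 < x_cutoff S \<epsilon>0 t1 x1" using \<epsilon>0 by (simp add: x_cutoff_def)
  moreover have "0 < yz_cutoff aB (-1) t1 y1 z1" using yz1 by (simp add: yz_cutoff_def)
  ultimately have "w (x1,y1,z1,t1) = 0" by (simp add: j_def weight_def)
  then show ?thesis by (simp add: w_def soft_abs_eq_0_iff d_def)
qed

section \<open>Uniqueness by iterating short time steps\<close>

theorem theorem7p3:
  fixes T :: ereal
    and u0 :: "real \<times> real \<times> real \<Rightarrow> real"
    and u v :: "real \<times> real \<times> real \<times> real \<Rightarrow> real"
  assumes "0 < T"
    and "continuous_on UNIV u0"
    and "\<And>p. 0 \<le> u0 p"
    and "positive_cauchy_solution T u0 u"
    and "positive_cauchy_solution T u0 v"
  shows "\<forall>p\<in>half_open_strip T. u p = v p"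
proof
  fix p assume "p \<in> half_open_strip T"
  then obtain x y z t where p: "p = (x,y,z,t)" and t: "0 \<le> t" "ereal t < T"
    by (auto simp: half_open_strip_def)
  \<comment> \<open>A real \<open>b\<close> strictly below \<open>T\<close> keeps the closed slab up
    to time \<open>b\<close> inside the domain of continuity, also for
    \<open>T = \<infinity>\<close>.\<close>
  obtain b where b: "t < b" "ereal b < T"
    using ereal_dense2[OF t(2)] by auto
  \<comment> \<open>With this choice \<open>t0 + 4 * \<sigma> \<le> b\<close> holds for every
    starting time \<open>t0 \<le> t\<close>, so steps of the fixed length
    \<open>\<sigma> / 2\<close> reach \<open>t\<close> after finitely many rounds.\<close>
  define \<sigma> where "\<sigma> = (b - t) / 4"
  have \<sigma>: "0 < \<sigma>" using b by (simp add: \<sigma>_def)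
  have strip: "(x,y,z,s) \<in> open_strip T" if "0 < s" "s < b" for x y z s
    using that b(2) less_trans[of "ereal s" "ereal b" T] by (auto simp: open_strip_def)
  have half: "slab {0..b} \<subseteq> half_open_strip T"
    using b(2) le_less_trans[of "ereal _" "ereal b" T] by (auto simp: slab_def half_open_strip_def)
  note sol = assms(4,5)[unfolded positive_cauchy_solution_def]
  obtain ut ux uxx uy uz where u: "classical_jet {0<..<b} u ut ux uxx uy uz"
    and mu: "\<And>x y z t. 0 < t \<Longrightarrow> t < b \<Longrightarrow> mumford u (x,y,z,t) =
       ut (x,y,z,t) - cos x * uy (x,y,z,t) - sin x * uz (x,y,z,t) - uxx (x,y,z,t)"
    using Cinf_on_jet[OF _ less_imp_le[OF b(2)], of u] sol(1) by blast
  obtain vt vx vxx vy vz where v: "classical_jet {0<..<b} v vt vx vxx vy vz"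
    and mv: "\<And>x y z t. 0 < t \<Longrightarrow> t < b \<Longrightarrow> mumford v (x,y,z,t) =
       vt (x,y,z,t) - cos x * vy (x,y,z,t) - sin x * vz (x,y,z,t) - vxx (x,y,z,t)"
    using Cinf_on_jet[OF _ less_imp_le[OF b(2)], of v] sol(2) by blast
  have eq: "ut (x,y,z,t) - uxx (x,y,z,t) - cos x * uy (x,y,z,t) - sin x * uz (x,y,z,t) = 0"
    "vt (x,y,z,t) - vxx (x,y,z,t) - cos x * vy (x,y,z,t) - sin x * vz (x,y,z,t) = 0"
    "0 \<le> u (x,y,z,t)" "0 \<le> v (x,y,z,t)"
    if "0 < t" "t < b" for x y z t
    using mu[OF that, of x y z] mv[OF that, of x y z] strip[OF that, of x y z] sol by auto
  have cont: "continuous_on (slab {0..b}) u" "continuous_on (slab {0..b}) v"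
    using sol half continuous_on_subset by blast+
  \<comment> \<open>The base case is the common initial value at \<open>s = 0\<close>; each
    successor applies \<open>vanishing_persists\<close> from
    \<open>t0 = real n * (\<sigma> / 2)\<close>.\<close>
  have "\<forall>x y z s. 0 \<le> s \<longrightarrow> s \<le> t \<longrightarrow> s \<le> real n * (\<sigma> / 2) \<longrightarrow> u (x,y,z,s) = v (x,y,z,s)" for n
  proof (induction n)
    case 0
    then show ?case using sol by (auto dest: antisym)
  next
    case (Suc n)
    show ?case
    proof (intro allI impI)
      fix x y z s assume s: "0 \<le> s" "s \<le> t" "s \<le> real (Suc n) * (\<sigma> / 2)"
      show "u (x,y,z,s) = v (x,y,z,s)"
      proof (cases "s \<le> real n * (\<sigma> / 2)")
        case True
        then show ?thesis using Suc s by blast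
      next
        case False
        define t0 where "t0 = real n * (\<sigma> / 2)"
        have t0: "0 \<le> t0" "t0 < s" "s \<le> t0 + \<sigma> / 2"
          using False s \<sigma> by (auto simp: t0_def algebra_simps)
        have "4 * \<sigma> = b - t" by (simp add: \<sigma>_def)
        then have "t0 + 4 * \<sigma> \<le> b" using s t0 by linarith
        moreover have "u (x,y,z,t0) = v (x,y,z,t0)" for x y z
          using Suc t0 s by (auto simp: t0_def)
        ultimately show ?thesis
          using vanishing_persists[OF u v eq(1) eq(2) eq(3) eq(4) cont \<sigma> t0(1) _ _ t0(2,3)] by blast
      qed
    qed
  qed
  moreover obtain n where "t / (\<sigma> / 2) \<le> real n" using real_arch_simple by blast
  then have "t \<le> real n * (\<sigma> / 2)" using \<sigma> by (simp add: divide_le_eq)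
  ultimately show "u p = v p" using t p by blast
qed

end
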